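(* Let $n\ge2$ and $m\ge1$, and consider the $n$-dimensional piecewise polynomial system described in the context, with $\varepsilon>0$ small enough. (i) If $m\ge2$, then, for every choice of the coefficients, the number of periodic orbits obtained by using the first order Melnikov vector function $M$ (that is, the number of $h=(h_1,h_3,\dots,h_n)$ with $h_1>0$, $M(h)=0$ and $\det DM(h)\ne0$) is at most $m^{n-1}$. (ii) If $m=1$, then the system can have $1$ periodic orbit obtained in this way: there is a choice of the coefficients for which, for all sufficiently small $\varepsilon>0$, the system has one periodic orbit bifurcating from the period annulus, corresponding to a zero $h$ of $M$ with $h_1>0$ and $\det DM(h)\neq0$.
   Context: **System.** For $\mathbf x=(x_1,\dots,x_n)^T\in\mathbb R^n$ consider $$\dot x_1=x_2+\varepsilon g^k_1(\mathbf x),\quad \dot x_2=-x_1+\varepsilon g^k_2(\mathbf x),\quad \dot x_i=\varepsilon g^k_i(\mathbf x)\ (3\le i\le n),$$ where $k=1$ on $\{x_1\ge0,x_2\ge0\}$, $k=2$ on $\{x_1>0,x_2<0\}$, $k=3$ on $\{x_1<0,x_2<0\}$, $k=4$ on $\{x_1<0,x_2>0\}$, and each $g^k_i$ ($k=1,2,3,4$, $i=1,\dots,n$) is an arbitrary real polynomial in $x_1,\dots,x_n$ of total degree at most $m$; the coefficients of all the $g^k_i$ are independent parameters. For $\varepsilon=0$ the system has the first integrals $H=\frac12(x_1^2+x_2^2),x_3,\dots,x_n$ and the family of periodic orbits $\{H=h_1,\ (x_3,\dots,x_n)=(h_3,\dots,h_n)\}$, $h_1>0$, $(h_3,\dots,h_n)\in\mathbb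 R^{n-2}$ (the period annulus), traversed clockwise in the $(x_1,x_2)$-plane. **Melnikov function.** Write $h=(h_1,h_3,\dots,h_n)$ with $h_1>0$, $\mathbf H=(H,x_3,\dots,x_n)^T$ and $A(h)=(0,\sqrt{2h_1},h_3,\dots,h_n)^T$. Let $A_\varepsilon(h)$ be the first return point to the half hyperplane $\{x_1=0,x_2>0\}$ of the orbit of the system starting at $A(h)$ (after passing successively through the regions $k=1,2,3,4$). Then $\mathbf H(A_\varepsilon(h))-\mathbf H(A(h))=\varepsilon F(h,\varepsilon)$ and the first order Melnikov vector function is $$M(h)=F(h,0)=\sum_{k=1}^4\int_{L^k_h}D\mathbf H(\mathbf x)g^k(\mathbf x)\,dt\in\mathbb R^{n-1},$$ where $g^k=(g^k_1,\dots,g^k_n)^T$, $D\mathbf H$ is the $(n-1)\times n$ Jacobian matrix, and $L^k_h$ is the part of the unperturbed periodic orbit with parameter $h$ lying in region $k$, with $t$ the time of the unperturbed system. A zero $h_0$ of $M$ with $\det DM(h_0)\neq0$ yields, for each sufficiently small $\varepsilon>0$, a unique periodic orbit of the system near the unperturbed periodic orbit with parameter $h_0$ (closing after one turn). *)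

theory Defs
  imports "HOL-Analysis.Analysis" "Jordan_Normal_Form.Determinant"
begin

text \<open>
  Coordinates carry their usual indices: a point of \<open>n\<close>-space is an extensional function on
  \<open>{1..n}\<close>, and a parameter \<open>h = (h\<^sub>1, h\<^sub>3, \<dots>, h\<^sub>n)\<close> is an extensional function on
  \<open>{1, 3, \<dots>, n}\<close>.
\<close>

definition points :: "nat \<Rightarrow> (nat \<Rightarrow> real) set" where
  "points n = {1..n} \<rightarrow>\<^sub>E UNIV"

definition pars :: "nat \<Rightarrow> nat set" where
  "pars n = insert 1 {3..n}"

definition annulus :: "nat \<Rightarrow> (nat \<Rightarrow> real) set" where
  "annulus n = {h \<in> pars n \<rightarrow>\<^sub>E UNIV. 0 < h 1}"

definition multi_indices :: "nat \<Rightarrow> nat \<Rightarrow> (nat \<Rightarrow> nat) set" where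
  "multi_indices n m = {\<alpha>. (\<forall>j. j \<notin> {1..n} \<longrightarrow> \<alpha> j = 0) \<and> (\<Sum>j=1..n. \<alpha> j) \<le> m}"

lemma finite_multi_indices: "finite (multi_indices n m)"
proof (rule finite_subset)
  show "multi_indices n m \<subseteq> {\<alpha>. \<forall>j. (j \<in> {1..n} \<longrightarrow> \<alpha> j \<in> {..m}) \<and> (j \<notin> {1..n} \<longrightarrow> \<alpha> j = 0)}"
  proof
    fix \<alpha> assume a: "\<alpha> \<in> multi_indices n m"
    have "\<alpha> j \<le> m" if "j \<in> {1..n}" for j
      using a member_le_sum[of j "{1..n}" \<alpha>] that by (auto simp: multi_indices_def)
    with a show "\<alpha> \<in> {\<alpha>. \<forall>j. (j \<in> {1..n} \<longrightarrow> \<alpha> j \<in> {..m}) \<and> (j \<notin> {1..n} \<longrightarrow> \<alpha> j = 0)}"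
      by (auto simp: multi_indices_def)
  qed
  show "finite {\<alpha>. \<forall>j. (j \<in> {1..n} \<longrightarrow> \<alpha> j \<in> {..m}) \<and> (j \<notin> {1..n} \<longrightarrow> \<alpha> j = (0::nat))}"
    by (rule finite_set_of_finite_funs) auto
qed

text \<open>
  The perturbation \<open>g k i\<close> (region \<open>k\<close>, component \<open>i\<close>): the polynomial of total degree at most
  \<open>m\<close> in \<open>x\<^sub>1, \<dots>, x\<^sub>n\<close> whose coefficient at the monomial with exponent \<open>\<alpha>\<close> is \<open>c k i \<alpha>\<close>.
\<close>

definition perturbation ::
  "nat \<Rightarrow> nat \<Rightarrow> (nat \<Rightarrow> nat \<Rightarrow> (nat \<Rightarrow> nat) \<Rightarrow> real) \<Rightarrow> nat \<Rightarrow> nat \<Rightarrow> (nat \<Rightarrow> real) \<Rightarrow> real" where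
  "perturbation n m c k i x = (\<Sum>\<alpha>\<in>multi_indices n m. c k i \<alpha> * (\<Prod>j=1..n. x j ^ \<alpha> j))"

definition region :: "nat \<Rightarrow> (nat \<Rightarrow> real) set" where
  "region k =
    (if k = 1 then {x. x 1 \<ge> 0 \<and> x 2 \<ge> 0}
     else if k = 2 then {x. x 1 > 0 \<and> x 2 < 0}
     else if k = 3 then {x. x 1 < 0 \<and> x 2 < 0}
     else if k = 4 then {x. x 1 < 0 \<and> x 2 > 0}
     else {})"

definition vfield ::
  "(nat \<Rightarrow> nat \<Rightarrow> (nat \<Rightarrow> real) \<Rightarrow> real) \<Rightarrow> real \<Rightarrow> nat \<Rightarrow> (nat \<Rightarrow> real) \<Rightarrow> nat \<Rightarrow> real" where
  "vfield g \<epsilon> k x i = (if i = 1 then x 2 else if i = 2 then - x 1 else 0) + \<epsilon> * g k i x"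

definition unperturbed_orbit :: "nat \<Rightarrow> (nat \<Rightarrow> real) \<Rightarrow> real \<Rightarrow> nat \<Rightarrow> real" where
  "unperturbed_orbit n h t =
    (\<lambda>i\<in>{1..n}. if i = 1 then sqrt (2 * h 1) * sin t
                else if i = 2 then sqrt (2 * h 1) * cos t
                else h i)"

lemma unperturbed_orbit_solves:
  assumes "2 \<le> n" "i \<in> {1..n}"
  shows "((\<lambda>s. unperturbed_orbit n h s i) has_real_derivative
           vfield g 0 k (unperturbed_orbit n h t) i) (at t)"
  using assms by (auto simp: unperturbed_orbit_def vfield_def intro!: derivative_eq_intros)

definition partial_deriv :: "((nat \<Rightarrow> real) \<Rightarrow> real) \<Rightarrow> nat \<Rightarrow> (nat \<Rightarrow> real) \<Rightarrow> real" where
  "partial_deriv f i x = deriv (\<lambda>s. f (x(i := s))) (x i)"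

text \<open>The first integrals \<open>(H, x\<^sub>3, \<dots>, x\<^sub>n)\<close>, indexed by \<open>pars n\<close>.\<close>

definition first_integral :: "(nat \<Rightarrow> real) \<Rightarrow> nat \<Rightarrow> real" where
  "first_integral x j = (if j = 1 then ((x 1)\<^sup>2 + (x 2)\<^sup>2) / 2 else x j)"

definition melnikov ::
  "nat \<Rightarrow> (nat \<Rightarrow> nat \<Rightarrow> (nat \<Rightarrow> real) \<Rightarrow> real) \<Rightarrow> (nat \<Rightarrow> real) \<Rightarrow> nat \<Rightarrow> real" where
  "melnikov n g h j =
    (\<Sum>k=1..4. integral {t \<in> {0..<2 * pi}. unperturbed_orbit n h t \<in> region k}
      (\<lambda>t. \<Sum>i=1..n. partial_deriv (\<lambda>x. first_integral x j) i (unperturbed_orbit n h t)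
                       * g k i (unperturbed_orbit n h t)))"

text \<open>Increasing enumeration of \<open>pars n\<close> by \<open>0, \<dots>, n - 2\<close>, the index range of JNF matrices.\<close>

definition par :: "nat \<Rightarrow> nat" where
  "par p = (if p = 0 then 1 else p + 2)"

lemma bij_betw_par: "2 \<le> n \<Longrightarrow> bij_betw par {0..<n - 1} (pars n)"
  by (rule bij_betw_byWitness[where f' = "\<lambda>j. if j = 1 then 0 else j - 2"])
     (auto simp: par_def pars_def)

definition melnikov_jacobian ::
  "nat \<Rightarrow> (nat \<Rightarrow> nat \<Rightarrow> (nat \<Rightarrow> real) \<Rightarrow> real) \<Rightarrow> (nat \<Rightarrow> real) \<Rightarrow> real mat" where
  "melnikov_jacobian n g h =
    Matrix.mat (n - 1) (n - 1)
      (\<lambda>(p, q). partial_deriv (\<lambda>h. melnikov n g h (par p)) (par q) h)"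

definition simple_zeros ::
  "nat \<Rightarrow> (nat \<Rightarrow> nat \<Rightarrow> (nat \<Rightarrow> real) \<Rightarrow> real) \<Rightarrow> (nat \<Rightarrow> real) set" where
  "simple_zeros n g =
    {h \<in> annulus n. (\<forall>j\<in>pars n. melnikov n g h j = 0) \<and>
                    Determinant.det (melnikov_jacobian n g h) \<noteq> 0}"

text \<open>
  A periodic solution closing after one turn, parametrised over one period \<open>[0, T]\<close>: it starts on
  the half hyperplane \<open>{x\<^sub>1 = 0, x\<^sub>2 > 0}\<close>, runs through the regions \<open>1, 2, 3, 4\<close> in this order
  during the time intervals \<open>(\<tau> 0, \<tau> 1), \<dots>, (\<tau> 3, \<tau> 4)\<close> and returns to its starting point. It is
  continuous, and solves the differential equation of region \<open>k\<close> on \<open>(\<tau> (k - 1), \<tau> k)\<close>; no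
  two-sided derivative is required at the switching times \<open>\<tau> k\<close>.
\<close>

definition one_turn_periodic ::
  "nat \<Rightarrow> (nat \<Rightarrow> nat \<Rightarrow> (nat \<Rightarrow> real) \<Rightarrow> real) \<Rightarrow> real \<Rightarrow> (real \<Rightarrow> nat \<Rightarrow> real) \<Rightarrow> real \<Rightarrow> bool" where
  "one_turn_periodic n g \<epsilon> x T \<longleftrightarrow>
    (\<forall>t\<in>{0..T}. x t \<in> points n) \<and>
    (\<forall>i\<in>{1..n}. continuous_on {0..T} (\<lambda>t. x t i)) \<and>
    x 0 1 = 0 \<and> x 0 2 > 0 \<and> x T = x 0 \<and>
    (\<exists>\<tau> :: nat \<Rightarrow> real. \<tau> 0 = 0 \<and> \<tau> 4 = T \<and>
      (\<forall>k\<in>{1..4}. \<tau> (k - 1) < \<tau> k \<and>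
        (\<forall>t\<in>{\<tau> (k - 1)<..<\<tau> k}. x t \<in> region k \<and>
          (\<forall>i\<in>{1..n}. ((\<lambda>s. x s i) has_real_derivative vfield g \<epsilon> k (x t) i) (at t)))))"

definition periodic_orbit ::
  "nat \<Rightarrow> (nat \<Rightarrow> nat \<Rightarrow> (nat \<Rightarrow> real) \<Rightarrow> real) \<Rightarrow> real \<Rightarrow> (nat \<Rightarrow> real) set \<Rightarrow> bool" where
  "periodic_orbit n g \<epsilon> \<Gamma> \<longleftrightarrow> (\<exists>x T. one_turn_periodic n g \<epsilon> x T \<and> \<Gamma> = x ` {0..T})"

definition within_nbhd :: "nat \<Rightarrow> (nat \<Rightarrow> real) \<Rightarrow> real \<Rightarrow> (nat \<Rightarrow> real) set \<Rightarrow> bool" where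
  "within_nbhd n h \<eta> \<Gamma> \<longleftrightarrow>
    (\<forall>y\<in>\<Gamma>. \<exists>t. L2_set (\<lambda>i. y i - unperturbed_orbit n h t i) {1..n} < \<eta>)"

text \<open>
  Every sufficiently small tubular neighbourhood of the unperturbed orbit with parameter \<open>h\<close>
  contains exactly one periodic orbit as soon as \<open>\<epsilon> > 0\<close> is small enough (how small may depend on
  the neighbourhood). In particular these orbits tend to the unperturbed one as \<open>\<epsilon>\<close> tends to 0.
\<close>

definition one_orbit_bifurcates ::
  "nat \<Rightarrow> (nat \<Rightarrow> nat \<Rightarrow> (nat \<Rightarrow> real) \<Rightarrow> real) \<Rightarrow> (nat \<Rightarrow> real) \<Rightarrow> bool" where
  "one_orbit_bifurcates n g h \<longleftrightarrow>
    (\<forall>\<^sub>F \<eta> in at_right 0. \<forall>\<^sub>F \<epsilon> in at_right 0.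
      \<exists>!\<Gamma>. periodic_orbit n g \<epsilon> \<Gamma> \<and> within_nbhd n h \<eta> \<Gamma>)"

end

theory Submission
  imports Defs "HOL-Real_Asymp.Real_Asymp"
begin

text \<open>
  With \<open>r = sqrt (2 h\<^sub>1)\<close> the Melnikov function is \<open>M\<^sub>1 = r P\<^sub>1\<close> and \<open>M\<^sub>j = P\<^sub>j\<close> for \<open>j \<ge> 3\<close>, with
  polynomials \<open>P\<^sub>j\<close> of degree at most \<open>m\<close> in the \<open>n - 1\<close> variables \<open>r, h\<^sub>3, \<dots>, h\<^sub>n\<close>. The bound is
  thus the Bezout bound for nondegenerate real zeros of \<open>N\<close> polynomials \<open>F\<close> in \<open>N\<close> variables, which
  has an elementary proof by counting dimensions. If \<open>b\<^sub>z\<close> are polynomials separating the points \<open>z\<close>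
  of a finite set \<open>Z\<close> of nondegenerate zeros, the products \<open>b\<^sub>z F\<^sup>\<beta>\<close> with \<open>|\<beta>| \<le> B\<close> are linearly
  independent and have degree at most \<open>m B + C\<close>, so \<open>|Z| S(B) \<le> S(m B + C) \<le> m\<^sup>N S(B + C)\<close>, where
  \<open>S(d)\<close> is the number of monomials of degree at most \<open>d\<close>. If \<open>|Z| > m\<^sup>N\<close>, then \<open>S\<close> grows
  exponentially, but \<open>S(d) \<le> (d + 1)\<^sup>N\<close>.

  For \<open>m = 1\<close> take the perturbation \<open>(1, 0)\<close> in region 1, \<open>(- x\<^sub>1, - x\<^sub>2)\<close> in region 2 and \<open>0\<close> in
  regions 3 and 4 for the first two components, and \<open>- x\<^sub>i\<close> everywhere for \<open>i \<ge> 3\<close>. The orbits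
  consist of a circular arc about \<open>(0, - \<epsilon>)\<close>, an arc of a spiral and a half circle; the return map
  sends \<open>\<rho>\<close> to \<open>exp (- \<epsilon> \<pi> / 2) sqrt ((\<rho> + \<epsilon>)\<^sup>2 - \<epsilon>\<^sup>2)\<close>, whose only positive fixed point
  \<open>2 \<epsilon> / (exp (\<pi> \<epsilon>) - 1)\<close> tends to \<open>2 / \<pi>\<close>, the zero of \<open>M\<^sub>1 = r - \<pi> r\<^sup>2 / 2\<close>.
\<close>

section \<open>The Bezout bound for nondegenerate real zeros\<close>

definition exponents :: "'i set \<Rightarrow> nat \<Rightarrow> ('i \<Rightarrow> nat) set" where
  "exponents I d = {\<alpha>. (\<forall>j. j \<notin> I \<longrightarrow> \<alpha> j = 0) \<and> sum \<alpha> I \<le> d}"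

definition monomial :: "'i set \<Rightarrow> ('i \<Rightarrow> nat) \<Rightarrow> ('i \<Rightarrow> real) \<Rightarrow> real" where
  "monomial I \<alpha> x = (\<Prod>j\<in>I. x j ^ \<alpha> j)"

lemma exponents_subset:
  assumes "finite I"
  shows "exponents I d \<subseteq> {\<alpha>. \<forall>j. (j \<in> I \<longrightarrow> \<alpha> j \<in> {..d}) \<and> (j \<notin> I \<longrightarrow> \<alpha> j = 0)}"
proof
  fix \<alpha> assume a: "\<alpha> \<in> exponents I d"
  have "\<alpha> j \<le> d" if "j \<in> I" for j
    using a member_le_sum[of j I \<alpha>] that assms by (auto simp: exponents_def)
  with a show "\<alpha> \<in> {\<alpha>. \<forall>j. (j \<in> I \<longrightarrow> \<alpha> j \<in> {..d}) \<and> (j \<notin> I \<longrightarrow> \<alpha> j = 0)}"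
    by (auto simp: exponents_def)
qed

lemma finite_exponents: "finite I \<Longrightarrow> finite (exponents I d)"
  by (rule finite_subset[OF exponents_subset finite_set_of_finite_funs]) auto

lemma card_exponents_pos: "finite I \<Longrightarrow> 0 < card (exponents I d)"
proof -
  assume "finite I"
  moreover have "(\<lambda>_. 0) \<in> exponents I d" by (simp add: exponents_def)
  ultimately show ?thesis using finite_exponents card_gt_0_iff by blast
qed

text \<open>A crude bound suffices: only the polynomial growth in \<open>d\<close>, for a fixed
  number of variables, is used.\<close>

lemma card_exponents_le:
  assumes "finite I"
  shows "card (exponents I d) \<le> (d + 1) ^ card I"
proof -
  let ?r = "\<lambda>\<alpha>::_\<Rightarrow>nat. restrict \<alpha> I"
  have inj: "inj_on ?r (exponents I d)"
  proof (rule inj_onI)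
    fix \<alpha> \<beta> assume ab: "\<alpha> \<in> exponents I d" "\<beta> \<in> exponents I d" "?r \<alpha> = ?r \<beta>"
    have "\<alpha> j = \<beta> j" for j
      using ab(1,2) fun_cong[OF ab(3), of j] by (cases "j \<in> I") (simp_all add: exponents_def)
    then show "\<alpha> = \<beta>" by auto
  qed
  have sub: "?r ` exponents I d \<subseteq> I \<rightarrow>\<^sub>E {..d}"
    using exponents_subset[OF assms, of d] by (force simp: PiE_def Pi_def)
  have "card (exponents I d) \<le> card (I \<rightarrow>\<^sub>E {..d})"
    using card_inj_on_le[OF inj sub] assms by (simp add: finite_PiE)
  also have "\<dots> = (d + 1) ^ card I" using assms by (simp add: card_funcsetE)
  finally show ?thesis .
qed

lemma card_exponents_scale:
  assumes I: "finite I" and m: "1 \<le> m"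
  shows "card (exponents I (m * B + C)) \<le> m ^ card I * card (exponents I (B + C))"
proof -
  \<comment> \<open>An exponent is determined by its quotient and remainder modulo \<open>m\<close>.\<close>
  let ?r = "\<lambda>\<alpha>::_\<Rightarrow>nat. (restrict (\<lambda>j. \<alpha> j mod m) I, \<lambda>j. \<alpha> j div m)"
  have inj: "inj_on ?r (exponents I (m * B + C))"
  proof (rule inj_onI)
    fix \<alpha> \<beta> assume ab: "\<alpha> \<in> exponents I (m * B + C)" "\<beta> \<in> exponents I (m * B + C)" "?r \<alpha> = ?r \<beta>"
    have "\<alpha> j = \<beta> j" for j
    proof (cases "j \<in> I")
      case True
      have "\<alpha> j mod m = \<beta> j mod m" "\<alpha> j div m = \<beta> j div m"
        using ab(3) True by (auto dest!: fun_cong[of _ _ j])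
      then show ?thesis by (metis mult_div_mod_eq)
    next
      case False then show ?thesis using ab by (auto simp: exponents_def)
    qed
    then show "\<alpha> = \<beta>" by auto
  qed
  have sub: "?r ` exponents I (m * B + C) \<subseteq> (I \<rightarrow>\<^sub>E {..<m}) \<times> exponents I (B + C)"
  proof (intro image_subsetI SigmaI)
    fix \<alpha> assume a: "\<alpha> \<in> exponents I (m * B + C)"
    show "(\<lambda>j\<in>I. \<alpha> j mod m) \<in> I \<rightarrow>\<^sub>E {..<m}" using m by auto
    have "m * (\<Sum>j\<in>I. \<alpha> j div m) \<le> sum \<alpha> I"
      by (simp add: sum_distrib_left sum_mono)
    also have "\<dots> \<le> m * B + C" using a by (simp add: exponents_def)
    also have "\<dots> \<le> m * (B + C)" using m by (simp add: algebra_simps)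
    finally have "(\<Sum>j\<in>I. \<alpha> j div m) \<le> B + C" using m by simp
    then show "(\<lambda>j. \<alpha> j div m) \<in> exponents I (B + C)"
      using a by (auto simp: exponents_def)
  qed
  have "card (exponents I (m * B + C)) \<le> card ((I \<rightarrow>\<^sub>E {..<m}) \<times> exponents I (B + C))"
    using card_inj_on_le[OF inj sub] I by (simp add: finite_PiE finite_exponents)
  also have "\<dots> = m ^ card I * card (exponents I (B + C))"
    using I by (simp add: card_cartesian_product card_funcsetE)
  finally show ?thesis .
qed

text \<open>Taking \<open>N\<close>-th roots reduces the claim to a linear function against the
  powers of some \<open>b > 1\<close>.\<close>

lemma exp_beats_poly:
  fixes a :: real
  assumes "1 < a"
  shows "\<exists>k. (real (k * C + 1)) ^ N < a ^ k"
proof (cases "N = 0")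
  case True
  then show ?thesis using assms by (intro exI[of _ 1]) auto
next
  case False
  define b where "b = root N a"
  have b: "1 < b" "b ^ N = a" using False assms by (auto simp: b_def)
  have "\<forall>\<^sub>F k in sequentially. real k * real C + 1 < b ^ k"
    using b(1) by real_asymp
  then obtain k where "real k * real C + 1 < b ^ k"
    by (auto simp: eventually_sequentially)
  then have "(real (k * C + 1)) ^ N < (b ^ k) ^ N"
    using False by (intro power_strict_mono) auto
  also have "(b ^ k) ^ N = a ^ k" using b by (metis power_mult mult.commute)
  finally show ?thesis by blast
qed

text \<open>If \<open>s\<close> exceeded \<open>m ^ card I\<close>, then by
  \<open>card_exponents_scale\<close> the number of exponents would grow by a fixed factor above 1
  whenever the degree grows by \<open>C\<close>, although it is bounded by a polynomial in the
  degree. For this \<open>C\<close> must be the same for all \<open>B\<close>.\<close>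

lemma exponents_count_bound:
  assumes I: "finite I" and m: "1 \<le> m"
    and le: "\<And>B. s * card (exponents I B) \<le> card (exponents I (m * B + C))"
  shows "s \<le> m ^ card I"
proof (rule ccontr)
  let ?S = "\<lambda>B. card (exponents I B)" and ?q = "m ^ card I"
  assume "\<not> s \<le> ?q"
  then have s: "?q + 1 \<le> s" by simp
  have q: "0 < ?q" using m by simp
  \<comment> \<open>With \<open>?q = m ^ card I\<close>, the integer \<open>s\<close> is at least
    \<open>?q + 1\<close>, and \<open>a\<close> is the quotient
    \<open>(?q + 1) / ?q\<close>.\<close>
  define a where "a = 1 + 1 / real ?q"
  have step: "a * real (?S B) \<le> real (?S (B + C))" for B
  proof -
    have "(?q + 1) * ?S B \<le> ?q * ?S (B + C)"
      using mult_right_mono[OF s, of "?S B"] le[of B] card_exponents_scale[OF I m, of B C] by linarith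
    then have "real ((?q + 1) * ?S B) \<le> real (?q * ?S (B + C))" by (simp only: of_nat_le_iff)
    then show ?thesis using q by (simp add: a_def field_simps)
  qed
  have pos: "1 < a" using q by (simp add: a_def)
  have grow: "a ^ k \<le> real (?S (k * C))" for k
  proof (induction k)
    case 0
    then show ?case using card_exponents_pos[OF I, of 0] by simp
  next
    case (Suc k)
    have "a ^ Suc k \<le> a * real (?S (k * C))" using Suc pos by simp
    also have "\<dots> \<le> real (?S (Suc k * C))" using step[of "k * C"] by (simp add: add.commute)
    finally show ?case .
  qed
  obtain k where k: "real (k * C + 1) ^ card I < a ^ k"
    using exp_beats_poly[OF pos] by blast
  have "real (?S (k * C)) \<le> real ((k * C + 1) ^ card I)"
    using card_exponents_le[OF I] of_nat_le_iff by blast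
  then show False using k grow[of k] by simp
qed

section \<open>Linear dependence and independence of monomials\<close>

lemma homogeneous_system_nontrivial:
  fixes a :: "'a \<Rightarrow> 'b \<Rightarrow> real"
  assumes "finite J" "finite I" "card J < card I"
  shows "\<exists>x. (\<exists>i\<in>I. x i \<noteq> 0) \<and> (\<forall>j\<in>J. (\<Sum>i\<in>I. x i * a i j) = 0)"
  using assms
proof (induction J arbitrary: I a rule: finite_induct)
  case empty
  then have "I \<noteq> {}" by auto
  then show ?case by (intro exI[of _ "\<lambda>_. 1"]) auto
next
  case (insert j0 J)
  show ?case
  proof (cases "\<forall>i\<in>I. a i j0 = 0")
    case True
    have "card J < card I" using insert by simp
    from insert.IH[OF insert.prems(1) this, of a] True show ?thesis by auto
  next
    case False
    then obtain p where p: "p \<in> I" "a p j0 \<noteq> 0" by auto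
    \<comment> \<open>One step of Gaussian elimination with pivot \<open>a p j0\<close>: now
      \<open>b i j0\<close> vanishes for every \<open>i\<close>, and one equation and one unknown
      drop out.\<close>
    define b where "b = (\<lambda>i j. a i j - a i j0 / a p j0 * a p j)"
    have "card J < card (I - {p})" using insert p by simp
    with insert.IH[of "I - {p}" b] insert.prems
    obtain x where x: "\<exists>i\<in>I-{p}. x i \<noteq> 0" "\<forall>j\<in>J. (\<Sum>i\<in>I-{p}. x i * b i j) = 0" by auto
    \<comment> \<open>The eliminated unknown is recovered from the equation
      \<open>j0\<close>.\<close>
    define y where "y = x(p := - (\<Sum>i\<in>I-{p}. x i * a i j0 / a p j0))"
    have *: "(\<Sum>i\<in>I. y i * a i j) = (\<Sum>i\<in>I-{p}. x i * b i j)" for j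
    proof -
      have "(\<Sum>i\<in>I. y i * a i j) = y p * a p j + (\<Sum>i\<in>I-{p}. y i * a i j)"
        using p insert.prems by (simp add: sum.remove)
      also have "(\<Sum>i\<in>I-{p}. y i * a i j) = (\<Sum>i\<in>I-{p}. x i * a i j)"
        by (rule sum.cong) (auto simp: y_def)
      also have "y p * a p j + \<dots> = (\<Sum>i\<in>I-{p}. x i * b i j)"
        by (simp add: y_def b_def sum_subtractf sum_distrib_right sum_distrib_left algebra_simps)
      finally show ?thesis .
    qed
    show ?thesis
    proof (intro exI[of _ y] conjI ballI)
      show "\<exists>i\<in>I. y i \<noteq> 0" using x(1) by (auto simp: y_def)
      fix j assume "j \<in> insert j0 J"
      then show "(\<Sum>i\<in>I. y i * a i j) = 0"
      proof
        assume "j = j0"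
        then show ?thesis using p by (simp only: *) (simp add: b_def)
      qed (use x(2) * in auto)
    qed
  qed
qed

text \<open>Induction on the variables: with the others fixed, the relation is a polynomial in the
  variable \<open>k\<close> that vanishes everywhere, so its coefficients are zero, and each of them
  is a relation between monomials in the variables of \<open>I\<close>.\<close>

lemma monomial_relation_trivial:
  assumes "finite I" "finite A" "A \<subseteq> {\<alpha>. \<forall>j. j \<notin> I \<longrightarrow> \<alpha> j = 0}"
    and "\<And>x. (\<Sum>\<alpha>\<in>A. c \<alpha> * monomial I \<alpha> x) = 0" and "\<alpha> \<in> A"
  shows "c \<alpha> = 0"
  using assms
proof (induction I arbitrary: A c \<alpha> rule: finite_induct)
  case empty
  have "\<beta> = (\<lambda>_. 0)" if "\<beta> \<in> A" for \<beta> using empty.prems(2) that by auto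
  then have "\<beta> = \<alpha>" if "\<beta> \<in> A" for \<beta> using empty.prems(4) that by metis
  with empty.prems(4) have "A = {\<alpha>}" by blast
  then show ?case using empty.prems(3) by (simp add: monomial_def)
next
  case (insert k I)
  define P where "P x = (\<Sum>\<beta>\<in>A. Polynomial.monom (c \<beta> * monomial I \<beta> x) (\<beta> k))" for x
  have P0: "P x = 0" for x
  proof -
    have "poly (P x) t = 0" for t
    proof -
      have "poly (P x) t = (\<Sum>\<beta>\<in>A. c \<beta> * monomial (insert k I) \<beta> (x(k := t)))"
        unfolding P_def poly_sum
      proof (rule sum.cong[OF refl])
        fix \<beta>
        have "monomial I \<beta> (x(k := t)) = monomial I \<beta> x"
          unfolding monomial_def using insert.hyps by (intro prod.cong) auto
        then have "monomial (insert k I) \<beta> (x(k := t)) = t ^ \<beta> k * monomial I \<beta> x"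
          using insert.hyps by (simp add: monomial_def)
        then show "poly (Polynomial.monom (c \<beta> * monomial I \<beta> x) (\<beta> k)) t
                   = c \<beta> * monomial (insert k I) \<beta> (x(k := t))"
          by (simp add: poly_monom)
      qed
      then show ?thesis using insert.prems(3) by simp
    qed
    then show ?thesis using poly_all_0_iff_0[of "P x"] by blast
  qed
  \<comment> \<open>The coefficient at the power \<open>\<alpha> k\<close> collects the exponents in
    \<open>?A\<close>. Resetting their entry at \<open>k\<close> to 0 gives them the support
    required by the induction hypothesis; \<open>?i\<close> undoes this.\<close>
  let ?A = "{\<beta> \<in> A. \<beta> k = \<alpha> k}" and ?z = "\<lambda>\<beta>::_\<Rightarrow>nat. \<beta>(k := 0)"
  let ?i = "\<lambda>\<beta>. \<beta>(k := \<alpha> k)"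
  have inj: "inj_on ?z ?A"
  proof (rule inj_onI)
    fix \<beta> \<gamma> assume "\<beta> \<in> ?A" "\<gamma> \<in> ?A" "?z \<beta> = ?z \<gamma>"
    then show "\<beta> = \<gamma>" by (metis (mono_tags, lifting) fun_upd_triv fun_upd_upd mem_Collect_eq)
  qed
  have sum0: "(\<Sum>\<beta>\<in>?z ` ?A. c (?i \<beta>) * monomial I \<beta> x) = 0" for x
  proof -
    have "(\<Sum>\<beta>\<in>?z ` ?A. c (?i \<beta>) * monomial I \<beta> x) = (\<Sum>\<beta>\<in>?A. c \<beta> * monomial I \<beta> x)"
      unfolding sum.reindex[OF inj] o_def
    proof (rule sum.cong[OF refl])
      fix \<beta> assume b: "\<beta> \<in> ?A"
      have "monomial I (?z \<beta>) x = monomial I \<beta> x"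
        unfolding monomial_def using insert.hyps by (intro prod.cong) auto
      moreover have "?i (?z \<beta>) = \<beta>" using b by auto
      ultimately show "c (?i (?z \<beta>)) * monomial I (?z \<beta>) x = c \<beta> * monomial I \<beta> x" by simp
    qed
    also have "\<dots> = (\<Sum>\<beta>\<in>A. if \<beta> k = \<alpha> k then c \<beta> * monomial I \<beta> x else 0)"
      using insert.prems(1) by (simp add: sum.inter_filter)
    also have "\<dots> = coeff (P x) (\<alpha> k)"
      by (auto simp: P_def coeff_sum intro!: sum.cong)
    finally show ?thesis by (simp add: P0)
  qed
  have "c (?i (?z \<alpha>)) = 0"
  proof (rule insert.IH[of "?z ` ?A" "\<lambda>\<beta>. c (?i \<beta>)" "?z \<alpha>"])
    show "?z ` ?A \<subseteq> {\<alpha>. \<forall>j. j \<notin> I \<longrightarrow> \<alpha> j = 0}" using insert.prems(2) by auto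
    show "?z \<alpha> \<in> ?z ` ?A" using insert.prems(4) by auto
    show "finite (?z ` ?A)" using insert.prems(1) by simp
  qed (rule sum0)
  then show ?case by simp
qed

section \<open>Polynomial functions with a degree bound\<close>

text \<open>\<open>d\<close> is only an upper bound of the degree, hence the slack in
  \<open>const\<close>, \<open>var\<close> and \<open>mult\<close>. The rules describe functions
  instead of coefficients, so that expansion and differentiability follow by induction over
  them.\<close>

inductive poly_fun :: "'i set \<Rightarrow> nat \<Rightarrow> (('i \<Rightarrow> real) \<Rightarrow> real) \<Rightarrow> bool" for I where
  const: "poly_fun I d (\<lambda>x. a)"
| var: "i \<in> I \<Longrightarrow> 1 \<le> d \<Longrightarrow> poly_fun I d (\<lambda>x. x i)"
| add: "poly_fun I d f \<Longrightarrow> poly_fun I d g \<Longrightarrow> poly_fun I d (\<lambda>x. f x + g x)"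
| mult: "poly_fun I d f \<Longrightarrow> poly_fun I e g \<Longrightarrow> d + e \<le> k \<Longrightarrow> poly_fun I k (\<lambda>x. f x * g x)"

lemma poly_fun_mono: "poly_fun I d f \<Longrightarrow> d \<le> e \<Longrightarrow> poly_fun I e f"
proof (induction arbitrary: e rule: poly_fun.induct)
  case (mult d1 f d2 g k)
  then show ?case using poly_fun.mult[OF mult.hyps(1,2)] by simp
qed (auto intro: poly_fun.intros)

lemma poly_fun_cmult: "poly_fun I d f \<Longrightarrow> poly_fun I d (\<lambda>x. a * f x)"
  using poly_fun.mult[OF poly_fun.const[of I 0 a]] by simp

lemma poly_fun_sum: "(\<And>a. a \<in> A \<Longrightarrow> poly_fun I d (f a)) \<Longrightarrow> poly_fun I d (\<lambda>x. \<Sum>a\<in>A. f a x)"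
  by (induction A rule: infinite_finite_induct) (auto intro: poly_fun.intros)

lemma poly_fun_power: "poly_fun I d f \<Longrightarrow> poly_fun I (k * d) (\<lambda>x. f x ^ k)"
  by (induction k) (auto intro: poly_fun.intros)

lemma poly_fun_prod:
  "(\<And>a. a \<in> A \<Longrightarrow> poly_fun I (d a) (f a)) \<Longrightarrow> poly_fun I (sum d A) (\<lambda>x. \<Prod>a\<in>A. f a x)"
proof (induction A rule: infinite_finite_induct)
  case (insert a A)
  then have "poly_fun I (d a) (f a)" "poly_fun I (sum d A) (\<lambda>x. \<Prod>a\<in>A. f a x)" by auto
  from poly_fun.mult[OF this order_refl] show ?case using insert.hyps by simp
qed (auto intro: poly_fun.intros)

lemma monomial_add: "monomial I (\<lambda>j. \<alpha> j + \<beta> j) x = monomial I \<alpha> x * monomial I \<beta> x"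
  by (simp add: monomial_def power_add prod.distrib)

text \<open>This places the functions in a space spanned by finitely many monomials, where
  dimensions can be compared. For a product the coefficients are convolved over the fibres of the
  addition of exponents.\<close>

lemma poly_fun_expansion:
  assumes "poly_fun I d f" and I: "finite I"
  shows "\<exists>a. \<forall>x. f x = (\<Sum>\<alpha>\<in>exponents I d. a \<alpha> * monomial I \<alpha> x)"
  using assms(1)
proof (induction rule: poly_fun.induct)
  case (const d b)
  have "(\<lambda>_. 0) \<in> exponents I d" by (simp add: exponents_def)
  then have "b = (\<Sum>\<alpha>\<in>exponents I d. (if \<alpha> = (\<lambda>_. 0) then b else 0) * monomial I \<alpha> x)" for x
    using finite_exponents[OF I, of d]
    by (simp add: if_distrib[of "\<lambda>c. c * _"] monomial_def cong: if_cong)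
  then show ?case by (intro exI allI)
next
  case (var i d)
  let ?u = "\<lambda>j. if j = i then 1 else 0::nat"
  have m: "?u \<in> exponents I d" using var I by (auto simp: exponents_def)
  have "monomial I ?u x = x i" for x
  proof -
    have "monomial I ?u x = (\<Prod>j\<in>I. if j = i then x j else 1)"
      unfolding monomial_def by (rule prod.cong) auto
    then show ?thesis using var I by simp
  qed
  then have "x i = (\<Sum>\<alpha>\<in>exponents I d. (if \<alpha> = ?u then 1 else 0) * monomial I \<alpha> x)" for x
    using finite_exponents[OF I, of d] m
    by (simp add: if_distrib[of "\<lambda>c. c * _"] cong: if_cong)
  then show ?case by (intro exI allI)
next
  case (add d f g)
  then obtain a b where
    "\<forall>x. f x = (\<Sum>\<alpha>\<in>exponents I d. a \<alpha> * monomial I \<alpha> x)"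
    "\<forall>x. g x = (\<Sum>\<alpha>\<in>exponents I d. b \<alpha> * monomial I \<alpha> x)" by blast
  then show ?case
    by (intro exI[of _ "\<lambda>\<alpha>. a \<alpha> + b \<alpha>"]) (simp add: sum.distrib algebra_simps)
next
  case (mult d f e g k)
  then obtain a b where
    a: "\<forall>x. f x = (\<Sum>\<alpha>\<in>exponents I d. a \<alpha> * monomial I \<alpha> x)" and
    b: "\<forall>x. g x = (\<Sum>\<alpha>\<in>exponents I e. b \<alpha> * monomial I \<alpha> x)" by blast
  let ?P = "exponents I d \<times> exponents I e" and ?p = "\<lambda>(\<alpha>, \<beta>). (\<lambda>j. \<alpha> j + \<beta> j :: nat)"
  let ?t = "\<lambda>(\<alpha>, \<beta>). a \<alpha> * b \<beta>"
  have sub: "?p ` ?P \<subseteq> exponents I k"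
    using mult.hyps(3) by (fastforce simp: exponents_def sum.distrib)
  have "f x * g x = (\<Sum>\<gamma>\<in>exponents I k. (\<Sum>q\<in>{q \<in> ?P. ?p q = \<gamma>}. ?t q) * monomial I \<gamma> x)" for x
  proof -
    have "f x * g x = (\<Sum>q\<in>?P. ?t q * monomial I (?p q) x)"
      by (simp add: a b sum_product sum.cartesian_product monomial_add case_prod_unfold algebra_simps)
    also have "\<dots> = (\<Sum>\<gamma>\<in>exponents I k. \<Sum>q\<in>{q \<in> ?P. ?p q = \<gamma>}. ?t q * monomial I (?p q) x)"
      by (rule sum.group[symmetric]) (use sub finite_exponents[OF I] in auto)
    also have "\<dots> = (\<Sum>\<gamma>\<in>exponents I k. (\<Sum>q\<in>{q \<in> ?P. ?p q = \<gamma>}. ?t q) * monomial I \<gamma> x)"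
      unfolding sum_distrib_right by (intro sum.cong) auto
    finally show ?thesis .
  qed
  then show ?case by (intro exI allI)
qed

text \<open>The order of the quantifiers matters: \<open>G\<close> is the gradient at
  \<open>z\<close> and serves all curves through \<open>z\<close>. The same numbers then describe
  the entries of a Jacobian and the derivatives along lines.\<close>

lemma poly_fun_gradient:
  assumes "poly_fun I d f" and I: "finite I"
  shows "\<exists>G. \<forall>c c' t. (\<forall>i\<in>I. ((\<lambda>s::real. c s i) has_real_derivative c' i) (at t)) \<longrightarrow> c t = z \<longrightarrow>
           ((\<lambda>s. f (c s)) has_real_derivative (\<Sum>i\<in>I. G i * c' i)) (at t)"
  using assms(1)
proof (induction rule: poly_fun.induct)
  case (const d a)
  show ?case by (rule exI[of _ "\<lambda>_. 0"]) simp
next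
  case (var i d)
  show ?case
    by (rule exI[of _ "\<lambda>j. if j = i then 1 else 0"])
      (use var I in \<open>simp add: if_distrib[of "\<lambda>c. c * _"] cong: if_cong\<close>)
next
  case (add d f g)
  then obtain G H where
    G: "\<And>c c' t. (\<forall>i\<in>I. ((\<lambda>s::real. c s i) has_real_derivative c' i) (at t)) \<Longrightarrow> c t = z \<Longrightarrow>
           ((\<lambda>s. f (c s)) has_real_derivative (\<Sum>i\<in>I. G i * c' i)) (at t)" and
    H: "\<And>c c' t. (\<forall>i\<in>I. ((\<lambda>s::real. c s i) has_real_derivative c' i) (at t)) \<Longrightarrow> c t = z \<Longrightarrow>
           ((\<lambda>s. g (c s)) has_real_derivative (\<Sum>i\<in>I. H i * c' i)) (at t)" by meson
  show ?case
    by (rule exI[of _ "\<lambda>i. G i + H i"])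
      (auto simp: distrib_right sum.distrib intro!: DERIV_add G H)
next
  case (mult d f e g k)
  then obtain G H where
    G: "\<And>c c' t. (\<forall>i\<in>I. ((\<lambda>s::real. c s i) has_real_derivative c' i) (at t)) \<Longrightarrow> c t = z \<Longrightarrow>
           ((\<lambda>s. f (c s)) has_real_derivative (\<Sum>i\<in>I. G i * c' i)) (at t)" and
    H: "\<And>c c' t. (\<forall>i\<in>I. ((\<lambda>s::real. c s i) has_real_derivative c' i) (at t)) \<Longrightarrow> c t = z \<Longrightarrow>
           ((\<lambda>s. g (c s)) has_real_derivative (\<Sum>i\<in>I. H i * c' i)) (at t)" by meson
  show ?case
  proof (rule exI[of _ "\<lambda>i. G i * g z + H i * f z"], intro allI impI)
    fix c c' t
    assume c: "\<forall>i\<in>I. ((\<lambda>s::real. c s i) has_real_derivative c' i) (at t)" "c t = z"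
    show "((\<lambda>s. f (c s) * g (c s)) has_real_derivative (\<Sum>i\<in>I. (G i * g z + H i * f z) * c' i)) (at t)"
      by (rule DERIV_cong[OF DERIV_mult[OF G[OF c] H[OF c]]])
        (simp add: c sum_distrib_left sum.distrib algebra_simps)
  qed
qed

text \<open>The product of the squared distances to the other points, in the coordinates of
  \<open>I\<close>, has this property, since a sum of real squares is zero only if all terms are.
  What matters about the degree bound is that it depends on \<open>card Z\<close> alone.\<close>

lemma poly_fun_separating:
  assumes I: "finite I" and Z: "finite Z" and z: "z \<in> Z"
    and dist: "\<And>y. y \<in> Z \<Longrightarrow> y \<noteq> z \<Longrightarrow> \<exists>j\<in>I. y j \<noteq> z j"
  shows "\<exists>b. poly_fun I (2 * card Z) b \<and> b z \<noteq> 0 \<and> (\<forall>y\<in>Z - {z}. b y = 0)"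
proof -
  define b :: "('a \<Rightarrow> real) \<Rightarrow> real" where
    "b = (\<lambda>x. \<Prod>y\<in>Z - {z}. \<Sum>j\<in>I. (x j + (- y j)) ^ 2)"
  have "poly_fun I (\<Sum>y\<in>Z - {z}. 2) b"
    unfolding b_def
  proof (intro poly_fun_prod poly_fun_sum)
    fix y :: "'a \<Rightarrow> real" and j assume "j \<in> I"
    then have "poly_fun I (2 * 1) (\<lambda>x. (x j + (- y j)) ^ 2)"
      by (intro poly_fun_power poly_fun.intros) auto
    then show "poly_fun I 2 (\<lambda>x. (x j + (- y j)) ^ 2)" by simp
  qed
  then have "poly_fun I (2 * card Z) b"
    by (rule poly_fun_mono) (use Z in \<open>simp add: card_Diff_subset_Int\<close>)
  moreover have "b z \<noteq> 0"
  proof -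
    have "(\<Sum>j\<in>I. (z j + (- y j)) ^ 2) \<noteq> 0" if y: "y \<in> Z - {z}" for y
    proof -
      obtain j where j: "j \<in> I" "y j \<noteq> z j" using dist[of y] y by fast
      then have "0 < (\<Sum>j\<in>I. (z j + (- y j)) ^ 2)"
        using I by (intro sum_pos2[of I j]) auto
      then show ?thesis by simp
    qed
    then show ?thesis using Z by (simp add: b_def)
  qed
  moreover have "b y = 0" if "y \<in> Z - {z}" for y
    unfolding b_def using Z that by (intro prod_zero bexI[of _ y]) auto
  ultimately show ?thesis by blast
qed

text \<open>
  Take an index \<open>(z, \<beta>\<^sub>0)\<close> of the relation with nonzero coefficient and \<open>|\<beta>\<^sub>0|\<close> minimal. On the line
  \<open>z + \<tau> u\<close> the part of lowest order in \<open>\<tau>\<close> is a form in the derivatives of the \<open>F k\<close> along \<open>u\<close>, and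
  these are arbitrary numbers.
\<close>

lemma separated_powers_independent:
  fixes F :: "'i \<Rightarrow> ('i \<Rightarrow> real) \<Rightarrow> real"
  assumes I: "finite I" and Z: "finite Z"
    and F: "\<And>k. k \<in> I \<Longrightarrow> poly_fun I m (F k)"
    and zero: "\<And>z k. z \<in> Z \<Longrightarrow> k \<in> I \<Longrightarrow> F k z = 0"
    and nondeg: "\<And>z v. z \<in> Z \<Longrightarrow> \<exists>u. \<forall>k\<in>I.
      ((\<lambda>\<tau>. F k (\<lambda>j. z j + \<tau> * u j)) has_real_derivative v k) (at 0)"
    and b: "\<And>z. z \<in> Z \<Longrightarrow> poly_fun I d (b z) \<and> b z z \<noteq> 0 \<and> (\<forall>y\<in>Z - {z}. b z y = 0)"
    and rel: "\<And>x. (\<Sum>z\<in>Z. \<Sum>\<beta>\<in>exponents I B. \<gamma> (z, \<beta>) * (b z x * monomial I \<beta> (\<lambda>k. F k x))) = 0"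
  shows "\<forall>p\<in>Z \<times> exponents I B. \<gamma> p = 0"
proof (rule ccontr)
  assume "\<not> ?thesis"
  then have ex: "\<exists>e z \<beta>. z \<in> Z \<and> \<beta> \<in> exponents I B \<and> \<gamma> (z, \<beta>) \<noteq> 0 \<and> sum \<beta> I = e"
    by auto
  define e where "e = (LEAST e. \<exists>z \<beta>. z \<in> Z \<and> \<beta> \<in> exponents I B \<and> \<gamma> (z, \<beta>) \<noteq> 0 \<and> sum \<beta> I = e)"
  from LeastI_ex[OF ex] obtain z \<beta>0 where
    z: "z \<in> Z" and \<beta>0: "\<beta>0 \<in> exponents I B" "\<gamma> (z, \<beta>0) \<noteq> 0" "sum \<beta>0 I = e"
    unfolding e_def by blast
  have low: "\<gamma> (y, \<beta>) = 0" if "y \<in> Z" "\<beta> \<in> exponents I B" "sum \<beta> I < e" for y \<beta>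
    using not_less_Least[OF that(3)[unfolded e_def]] that(1,2) by blast
  \<comment> \<open>Truncated subtraction and \<open>0 ^ 0 = 1\<close> make the last factor 1 for
    \<open>sum \<beta> I \<le> e\<close> and 0 otherwise; below \<open>e\<close> the coefficient
    vanishes by \<open>low\<close>. So only the exponents with sum exactly \<open>e\<close> survive
    in \<open>c\<close>.\<close>
  define c where "c \<beta> = \<gamma> (z, \<beta>) * b z z * 0 ^ (sum \<beta> I - e)" for \<beta>
  have "(\<Sum>\<beta>\<in>exponents I B. c \<beta> * monomial I \<beta> v) = 0" for v
  proof -
    obtain u where u: "\<And>k. k \<in> I \<Longrightarrow>
        ((\<lambda>\<tau>. F k (\<lambda>j. z j + \<tau> * u j)) has_real_derivative v k) (at 0)"
      using nondeg[OF z, of v] by blast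
    define L where "L \<tau> = (\<lambda>j. z j + \<tau> * u j)" for \<tau> :: real
    \<comment> \<open>\<open>q\<close> consists of difference quotients, because
      \<open>F k z = 0\<close>. \<open>S\<close> is the relation at \<open>L \<tau>\<close> divided
      by \<open>\<tau> ^ e\<close>: it is zero for \<open>\<tau> \<noteq> 0\<close> and still has a
      limit at 0.\<close>
    define q where "q \<tau> k = F k (L \<tau>) / \<tau>" for \<tau> k
    define S where "S \<tau> = (\<Sum>y\<in>Z. \<Sum>\<beta>\<in>exponents I B.
        \<gamma> (y, \<beta>) * b y (L \<tau>) * monomial I \<beta> (q \<tau>) * \<tau> ^ (sum \<beta> I - e))" for \<tau>
    have L0: "L 0 = z" by (simp add: L_def)
    have q: "((\<lambda>\<tau>. q \<tau> k) \<longlongrightarrow> v k) (at 0)" if "k \<in> I" for k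
      using u[OF that] zero[OF z that] by (simp add: DERIV_def q_def L_def)
    have bcont: "((\<lambda>\<tau>. b y (L \<tau>)) \<longlongrightarrow> b y z) (at 0)" if "y \<in> Z" for y
    proof -
      have "\<forall>i\<in>I. ((\<lambda>\<tau>. L \<tau> i) has_real_derivative u i) (at 0)"
        by (auto simp: L_def intro!: derivative_eq_intros)
      moreover obtain G where "\<forall>c c' t. (\<forall>i\<in>I. ((\<lambda>s::real. c s i) has_real_derivative c' i) (at t))
          \<longrightarrow> c t = z \<longrightarrow> ((\<lambda>s. b y (c s)) has_real_derivative (\<Sum>i\<in>I. G i * c' i)) (at t)"
        using poly_fun_gradient[OF conjunct1[OF b[OF \<open>y \<in> Z\<close>]] I] by blast
      ultimately have "((\<lambda>\<tau>. b y (L \<tau>)) has_real_derivative (\<Sum>i\<in>I. G i * u i)) (at 0)"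
        using L0 by blast
      from DERIV_isCont[OF this] show ?thesis by (simp add: isCont_def L0)
    qed
    have S0: "S \<tau> = 0" if "\<tau> \<noteq> 0" for \<tau>
    proof -
      have "S \<tau> * \<tau> ^ e = (\<Sum>y\<in>Z. \<Sum>\<beta>\<in>exponents I B.
          \<gamma> (y, \<beta>) * (b y (L \<tau>) * monomial I \<beta> (\<lambda>k. F k (L \<tau>))))"
        unfolding S_def sum_distrib_right
      proof (intro sum.cong refl)
        fix y \<beta> assume *: "y \<in> Z" "\<beta> \<in> exponents I B"
        have mon: "monomial I \<beta> (\<lambda>k. F k (L \<tau>)) = monomial I \<beta> (q \<tau>) * \<tau> ^ sum \<beta> I"
          using that by (simp add: monomial_def q_def power_sum prod.distrib[symmetric] power_divide)
        show "\<gamma> (y, \<beta>) * b y (L \<tau>) * monomial I \<beta> (q \<tau>) * \<tau> ^ (sum \<beta> I - e) * \<tau> ^ e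
          = \<gamma> (y, \<beta>) * (b y (L \<tau>) * monomial I \<beta> (\<lambda>k. F k (L \<tau>)))"
        proof (cases "sum \<beta> I < e")
          case True then show ?thesis using low[OF *] by simp
        next
          case False
          then have "\<tau> ^ sum \<beta> I = \<tau> ^ (sum \<beta> I - e) * \<tau> ^ e"
            by (simp flip: power_add)
          then show ?thesis by (simp add: mon)
        qed
      qed
      then show ?thesis using rel[of "L \<tau>"] that by simp
    qed
    have "(S \<longlongrightarrow> (\<Sum>y\<in>Z. \<Sum>\<beta>\<in>exponents I B.
        \<gamma> (y, \<beta>) * b y z * monomial I \<beta> v * 0 ^ (sum \<beta> I - e))) (at 0)"
      unfolding S_def monomial_def by (intro tendsto_intros bcont q)
    moreover have "(S \<longlongrightarrow> 0) (at 0)"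
      by (rule tendsto_eventually) (auto simp: eventually_at_filter S0)
    ultimately have "(\<Sum>y\<in>Z. \<Sum>\<beta>\<in>exponents I B.
        \<gamma> (y, \<beta>) * b y z * monomial I \<beta> v * 0 ^ (sum \<beta> I - e)) = 0"
      using LIM_unique by blast
    moreover have "(\<Sum>y\<in>Z. \<Sum>\<beta>\<in>exponents I B.
        \<gamma> (y, \<beta>) * b y z * monomial I \<beta> v * 0 ^ (sum \<beta> I - e)) = (\<Sum>\<beta>\<in>exponents I B. c \<beta> * monomial I \<beta> v)"
    proof -
      \<comment> \<open>In the limit only the point \<open>z\<close> contributes, since
        \<open>b y z = 0\<close> for all other \<open>y\<close>.\<close>
      have "(\<Sum>\<beta>\<in>exponents I B. \<gamma> (y, \<beta>) * b y z * monomial I \<beta> v * 0 ^ (sum \<beta> I - e)) = 0"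
        if "y \<in> Z - {z}" for y
        using b[of y] z that by (intro sum.neutral) auto
      then show ?thesis
        using z Z by (subst sum.remove[of Z z]) (auto simp: c_def mult_ac)
    qed
    ultimately show ?thesis by simp
  qed
  from monomial_relation_trivial[OF I finite_exponents[OF I] _ this \<beta>0(1)]
  have "c \<beta>0 = 0" by (auto simp: exponents_def)
  then show False using \<beta>0 b[OF z] by (simp add: c_def)
qed

text \<open>Nondegeneracy is stated as surjectivity: every vector \<open>v\<close> consists of the
  derivatives of the \<open>F k\<close> along some line through \<open>z\<close>. This needs no
  matrices and is the form in which the independence lemma uses it.\<close>

lemma bezout_nondegenerate_zeros:
  fixes F :: "'i \<Rightarrow> ('i \<Rightarrow> real) \<Rightarrow> real"
  assumes I: "finite I" and Z: "finite Z" and m: "1 \<le> m"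
    and F: "\<And>k. k \<in> I \<Longrightarrow> poly_fun I m (F k)"
    and dist: "\<And>y z. y \<in> Z \<Longrightarrow> z \<in> Z \<Longrightarrow> y \<noteq> z \<Longrightarrow> \<exists>j\<in>I. y j \<noteq> z j"
    and zero: "\<And>z k. z \<in> Z \<Longrightarrow> k \<in> I \<Longrightarrow> F k z = 0"
    and nondeg: "\<And>z v. z \<in> Z \<Longrightarrow> \<exists>u. \<forall>k\<in>I.
      ((\<lambda>\<tau>. F k (\<lambda>j. z j + \<tau> * u j)) has_real_derivative v k) (at 0)"
  shows "card Z \<le> m ^ card I"
proof -
  define C where "C = 2 * card Z"
  have "\<forall>z\<in>Z. \<exists>b. poly_fun I C b \<and> b z \<noteq> 0 \<and> (\<forall>y\<in>Z - {z}. b y = 0)"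
    unfolding C_def using poly_fun_separating[OF I Z] dist by blast
  then obtain b where b: "\<And>z. z \<in> Z \<Longrightarrow> poly_fun I C (b z) \<and> b z z \<noteq> 0 \<and> (\<forall>y\<in>Z - {z}. b z y = 0)"
    by metis
  show ?thesis
  proof (rule exponents_count_bound[OF I m])
    fix B
    show "card Z * card (exponents I B) \<le> card (exponents I (m * B + C))"
    proof (rule ccontr)
      let ?P = "Z \<times> exponents I B" and ?E = "exponents I (m * B + C)"
      let ?f = "\<lambda>p x. b (fst p) x * monomial I (snd p) (\<lambda>k. F k x)"
      assume "\<not> ?thesis"
      then have less: "card ?E < card ?P" by (simp add: card_cartesian_product)
      have "\<forall>p\<in>?P. \<exists>a. \<forall>x. ?f p x = (\<Sum>\<alpha>\<in>?E. a \<alpha> * monomial I \<alpha> x)"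
      proof
        fix p assume p: "p \<in> ?P"
        have "poly_fun I (\<Sum>k\<in>I. snd p k * m) (\<lambda>x. monomial I (snd p) (\<lambda>k. F k x))"
          unfolding monomial_def by (intro poly_fun_prod poly_fun_power F)
        moreover have "(\<Sum>k\<in>I. snd p k * m) \<le> m * B"
          using p by (auto simp: exponents_def mult.commute[of m] simp flip: sum_distrib_right)
        ultimately have "poly_fun I (m * B + C) (?f p)"
          using b p by (intro poly_fun.mult[of I C _ "\<Sum>k\<in>I. snd p k * m"]) auto
        then show "\<exists>a. \<forall>x. ?f p x = (\<Sum>\<alpha>\<in>?E. a \<alpha> * monomial I \<alpha> x)"
          using poly_fun_expansion I by blast
      qed
      from bchoice[OF this] obtain a where
        a: "\<forall>p\<in>?P. \<forall>x. ?f p x = (\<Sum>\<alpha>\<in>?E. a p \<alpha> * monomial I \<alpha> x)" by blast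
      \<comment> \<open>With more products than monomials, some nontrivial combination has all
        expansion coefficients zero and hence vanishes identically.\<close>
      obtain \<gamma> where \<gamma>: "\<exists>p\<in>?P. \<gamma> p \<noteq> 0" "\<forall>\<alpha>\<in>?E. (\<Sum>p\<in>?P. \<gamma> p * a p \<alpha>) = 0"
        using homogeneous_system_nontrivial[OF finite_exponents[OF I] _ less, of a] Z I
        by (auto simp: finite_exponents)
      have "(\<Sum>z\<in>Z. \<Sum>\<beta>\<in>exponents I B. \<gamma> (z, \<beta>) * (b z x * monomial I \<beta> (\<lambda>k. F k x))) = 0" for x
      proof -
        have "(\<Sum>z\<in>Z. \<Sum>\<beta>\<in>exponents I B. \<gamma> (z, \<beta>) * (b z x * monomial I \<beta> (\<lambda>k. F k x)))
          = (\<Sum>p\<in>?P. \<gamma> p * ?f p x)"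
          by (simp add: sum.cartesian_product case_prod_unfold)
        also have "\<dots> = (\<Sum>p\<in>?P. \<Sum>\<alpha>\<in>?E. \<gamma> p * a p \<alpha> * monomial I \<alpha> x)"
          by (intro sum.cong refl) (simp add: a sum_distrib_left mult.assoc)
        also have "\<dots> = (\<Sum>\<alpha>\<in>?E. (\<Sum>p\<in>?P. \<gamma> p * a p \<alpha>) * monomial I \<alpha> x)"
          by (subst sum.swap) (simp add: sum_distrib_right)
        also have "\<dots> = 0" using \<gamma>(2) by simp
        finally show ?thesis .
      qed
      from separated_powers_independent[OF I Z F zero nondeg b this] \<gamma>(1) show False by blast
    qed
  qed
qed

section \<open>The Melnikov function\<close>

text \<open>Closed also where the set of times is open, so that continuous functions are integrable
  on it directly; the end points do not affect the integrals.\<close>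

definition quarter :: "nat \<Rightarrow> real set" where
  "quarter k = {real (k - 1) * (pi / 2)..real k * (pi / 2)}"

text \<open>The first two coordinates are a positive multiple of \<open>(sin t, cos t)\<close>, so
  the region is read off from two signs.\<close>

lemma orbit_region_times:
  assumes n: "2 \<le> n" and h: "0 < h 1" and k: "k \<in> {1..4}"
  shows "{t \<in> {0..<2 * pi}. unperturbed_orbit n h t \<in> region k} =
    (if k = 1 then quarter k else {real (k - 1) * (pi / 2)<..<real k * (pi / 2)})"
proof -
  have in_region: "unperturbed_orbit n h t \<in> region k \<longleftrightarrow>
      (if k = 1 then 0 \<le> sin t \<and> 0 \<le> cos t else if k = 2 then 0 < sin t \<and> cos t < 0
       else if k = 3 then sin t < 0 \<and> cos t < 0 else sin t < 0 \<and> 0 < cos t)" for t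
    using n h k
    by (auto simp: region_def unperturbed_orbit_def zero_le_mult_iff zero_less_mult_iff mult_less_0_iff)
  have cos_shift: "cos t = - cos (t - pi)" "sin t = - sin (t - pi)" for t :: real
    by (simp_all add: cos_diff sin_diff)
  have sgn1: "0 \<le> sin t \<and> 0 \<le> cos t" if "0 \<le> t" "t \<le> pi / 2" for t
    using that by (auto intro: sin_ge_zero cos_ge_zero)
  have sgn2: "0 < sin t \<and> cos t < 0" if "pi / 2 < t" "t < pi" for t
    using that cos_gt_zero_pi[of "t - pi"] by (auto intro: sin_gt_zero simp: cos_shift(1)[of t] simp del: cos_minus_pi)
  have sgn3: "sin t < 0 \<and> cos t < 0" if "pi < t" "t < 3 * pi / 2" for t
    using that cos_gt_zero_pi[of "t - pi"] sin_gt_zero[of "t - pi"]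
    by (auto simp: cos_shift[of t] simp del: cos_minus_pi sin_minus_pi)
  have sgn4: "sin t < 0 \<and> 0 < cos t" if "3 * pi / 2 < t" "t < 2 * pi" for t
  proof -
    have "cos t = cos (t - 2 * pi)" "sin t = sin (t - 2 * pi)" by (simp_all add: cos_diff sin_diff)
    then show ?thesis using that cos_gt_zero_pi[of "t - 2 * pi"] sin_lt_zero[of t] by auto
  qed
  \<comment> \<open>At the times \<open>pi\<close> and \<open>3 * pi / 2\<close> the orbit is on an
    axis outside all four regions.\<close>
  have cases: "t \<in> {0..pi/2} \<or> t \<in> {pi/2<..<pi} \<or> t = pi \<or> t \<in> {pi<..<3*pi/2} \<or> t = 3*pi/2
      \<or> t \<in> {3*pi/2<..<2*pi}" if "t \<in> {0..<2*pi}" for t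
    using that by auto
  have half3: "sin (3 * pi / 2) = - 1" "cos (3 * pi / 2) = 0"
    using cos_shift[of "3 * pi / 2"] by (simp_all add: field_simps)
  have k': "k = 1 \<or> k = 2 \<or> k = 3 \<or> k = 4" using k by auto
  have "t \<in> {0..<2 * pi} \<and> unperturbed_orbit n h t \<in> region k \<longleftrightarrow>
    t \<in> (if k = 1 then quarter k else {real (k - 1) * (pi / 2)<..<real k * (pi / 2)})" for t
  proof (cases "t \<in> {0..<2*pi}")
    case True
    consider "t \<in> {0..pi/2}" | "t \<in> {pi/2<..<pi}" | "t = pi" | "t \<in> {pi<..<3*pi/2}" | "t = 3*pi/2"
      | "t \<in> {3*pi/2<..<2*pi}" using cases[OF True] by blast
    then show ?thesis
    proof cases
      case 1 with k' sgn1[of t] True show ?thesis unfolding in_region by (auto simp: quarter_def)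
    next
      case 2 with k' sgn2[of t] True show ?thesis unfolding in_region by (auto simp: quarter_def)
    next
      case 3 with k' True show ?thesis unfolding in_region by (auto simp: quarter_def)
    next
      case 4 with k' sgn3[of t] True show ?thesis unfolding in_region by (auto simp: quarter_def)
    next
      case 5
      have "sin t = - 1" "cos t = 0" unfolding 5 by (rule half3)+
      with 5 k' True show ?thesis unfolding in_region by (auto simp: quarter_def)
    next
      case 6 with k' sgn4[of t] True show ?thesis unfolding in_region by (auto simp: quarter_def)
    qed
  next
    case False
    then have "t < 0 \<or> 2 * pi \<le> t" by auto
    moreover from this have "t < 0 \<or> pi / 2 < t" using pi_gt_zero by linarith
    ultimately show ?thesis using k' False by (auto simp: quarter_def)
  qed
  then show ?thesis by blast
qed

lemma melnikov_quarters:
  assumes "2 \<le> n" "0 < h 1"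
  shows "melnikov n g h j = (\<Sum>k=1..4. integral (quarter k)
      (\<lambda>t. \<Sum>i=1..n. partial_deriv (\<lambda>x. first_integral x j) i (unperturbed_orbit n h t)
                       * g k i (unperturbed_orbit n h t)))"
  unfolding melnikov_def
proof (rule sum.cong[OF refl])
  fix k :: nat assume "k \<in> {1..4}"
  then show "integral {t \<in> {0..<2 * pi}. unperturbed_orbit n h t \<in> region k}
      (\<lambda>t. \<Sum>i=1..n. partial_deriv (\<lambda>x. first_integral x j) i (unperturbed_orbit n h t)
                       * g k i (unperturbed_orbit n h t)) = integral (quarter k)
      (\<lambda>t. \<Sum>i=1..n. partial_deriv (\<lambda>x. first_integral x j) i (unperturbed_orbit n h t)
                       * g k i (unperturbed_orbit n h t))"
    unfolding orbit_region_times[of n h, OF assms \<open>k \<in> {1..4}\<close>]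
    by (simp add: quarter_def integral_open_interval_real)
qed

lemma partial_deriv_first_integral:
  "partial_deriv (\<lambda>x. first_integral x j) i x =
     (if j = 1 then (if i = 1 \<or> i = 2 then x i else 0) else if i = j then 1 else 0)"
  unfolding partial_deriv_def
  by (intro DERIV_imp_deriv)
    (auto simp: first_integral_def intro!: derivative_eq_intros)

lemma melnikov_integrand:
  assumes n: "2 \<le> n" and j: "j \<in> pars n"
  shows "(\<Sum>i=1..n. partial_deriv (\<lambda>x. first_integral x j) i x * g i) =
     (if j = 1 then x 1 * g 1 + x 2 * g 2 else g j)"
proof (cases "j = 1")
  case True
  have "(\<Sum>i=1..n. partial_deriv (\<lambda>x. first_integral x j) i x * g i) = (\<Sum>i\<in>{1,2}. x i * g i)"
    by (rule sum.mono_neutral_cong_right)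
      (use True n in \<open>auto simp: partial_deriv_first_integral\<close>)
  then show ?thesis using True by simp
next
  case False
  have "(\<Sum>i=1..n. partial_deriv (\<lambda>x. first_integral x j) i x * g i) = (\<Sum>i\<in>{j}. g i)"
    by (rule sum.mono_neutral_cong_right)
      (use False j in \<open>auto simp: partial_deriv_first_integral pars_def\<close>)
  then show ?thesis using False by simp
qed

lemma prod_head:
  fixes f :: "nat \<Rightarrow> 'a :: comm_monoid_mult"
  assumes "2 \<le> n" shows "(\<Prod>j=1..n. f j) = f 1 * f 2 * (\<Prod>j=3..n. f j)"
proof -
  have "(\<Prod>j=1..n. f j) = f 1 * (\<Prod>j=Suc 1..n. f j)" using assms by (simp add: prod.atLeast_Suc_atMost)
  also have "(\<Prod>j=Suc 1..n. f j) = f 2 * (\<Prod>j=3..n. f j)"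
    using assms by (simp add: prod.atLeast_Suc_atMost numeral_2_eq_2 numeral_3_eq_3)
  finally show ?thesis by (simp add: mult.assoc)
qed

lemma sum_head:
  fixes f :: "nat \<Rightarrow> 'a :: comm_monoid_add"
  assumes "2 \<le> n" shows "(\<Sum>j=1..n. f j) = f 1 + f 2 + (\<Sum>j=3..n. f j)"
proof -
  have "(\<Sum>j=1..n. f j) = f 1 + (\<Sum>j=Suc 1..n. f j)" using assms by (simp add: sum.atLeast_Suc_atMost)
  also have "(\<Sum>j=Suc 1..n. f j) = f 2 + (\<Sum>j=3..n. f j)"
    using assms by (simp add: sum.atLeast_Suc_atMost numeral_2_eq_2 numeral_3_eq_3)
  finally show ?thesis by (simp add: add.assoc)
qed

section \<open>Reduction to polynomials in the radius\<close>

text \<open>The points of the unperturbed orbit are linear in the entries of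
  \<open>radial h\<close>, which makes the Melnikov integrals polynomial in them.\<close>

definition radial :: "(nat \<Rightarrow> real) \<Rightarrow> nat \<Rightarrow> real" where
  "radial h = h(1 := sqrt (2 * h 1))"

text \<open>The time-independent part of the monomial with exponent \<open>\<alpha>\<close> on the
  orbit; both planar coordinates are proportional to the radius, so their exponents add up.\<close>

definition reduced_monomial :: "nat \<Rightarrow> (nat \<Rightarrow> nat) \<Rightarrow> (nat \<Rightarrow> real) \<Rightarrow> real" where
  "reduced_monomial n \<alpha> y = y 1 ^ (\<alpha> 1 + \<alpha> 2) * (\<Prod>j=3..n. y j ^ \<alpha> j)"

lemma poly_fun_reduced_monomial:
  assumes "2 \<le> n" "\<alpha> \<in> multi_indices n m"
  shows "poly_fun (pars n) m (reduced_monomial n \<alpha>)"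
proof -
  have "poly_fun (pars n) ((\<alpha> 1 + \<alpha> 2) * 1) (\<lambda>y. y 1 ^ (\<alpha> 1 + \<alpha> 2))"
    by (intro poly_fun_power poly_fun.var) (auto simp: pars_def)
  moreover have "poly_fun (pars n) (\<Sum>j=3..n. \<alpha> j * 1) (\<lambda>y. \<Prod>j=3..n. y j ^ \<alpha> j)"
    by (intro poly_fun_prod poly_fun_power poly_fun.var) (auto simp: pars_def)
  ultimately have "poly_fun (pars n) m (\<lambda>y. y 1 ^ (\<alpha> 1 + \<alpha> 2) * (\<Prod>j=3..n. y j ^ \<alpha> j))"
    by (rule poly_fun.mult) (use assms sum_head[of n \<alpha>] in \<open>simp add: multi_indices_def\<close>)
  then show ?thesis unfolding reduced_monomial_def[abs_def] .
qed

lemma perturbation_on_orbit: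
  assumes "2 \<le> n"
  shows "perturbation n m c k i (unperturbed_orbit n h t) =
    (\<Sum>\<alpha>\<in>multi_indices n m. c k i \<alpha> * (sin t ^ \<alpha> 1 * cos t ^ \<alpha> 2) * reduced_monomial n \<alpha> (radial h))"
  unfolding perturbation_def
proof (rule sum.cong[OF refl])
  fix \<alpha>
  have "(\<Prod>j=3..n. unperturbed_orbit n h t j ^ \<alpha> j) = (\<Prod>j=3..n. radial h j ^ \<alpha> j)"
    by (rule prod.cong) (auto simp: unperturbed_orbit_def radial_def)
  then show "c k i \<alpha> * (\<Prod>j=1..n. unperturbed_orbit n h t j ^ \<alpha> j)
    = c k i \<alpha> * (sin t ^ \<alpha> 1 * cos t ^ \<alpha> 2) * reduced_monomial n \<alpha> (radial h)"
    unfolding prod_head[OF assms]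
    using assms by (simp add: reduced_monomial_def unperturbed_orbit_def radial_def power_mult_distrib power_add)
qed

text \<open>For \<open>j = 1\<close> the gradient of \<open>H\<close> brings one extra factor of the
  radius. It is split off here, as it would raise the degree bound to \<open>m + 1\<close>. The
  coefficients of \<open>F\<close> are trigonometric integrals over the quarter turns.\<close>

lemma melnikov_eq_poly_fun:
  assumes n: "2 \<le> n" and j: "j \<in> pars n"
  shows "\<exists>F. poly_fun (pars n) m F \<and> (\<forall>h. 0 < h 1 \<longrightarrow>
    melnikov n (perturbation n m c) h j = (if j = 1 then sqrt (2 * h 1) else 1) * F (radial h))"
proof -
  define w where "w k \<alpha> t = (if j = 1 then c k 1 \<alpha> * (sin t ^ (\<alpha> 1 + 1) * cos t ^ \<alpha> 2)
       + c k 2 \<alpha> * (sin t ^ \<alpha> 1 * cos t ^ (\<alpha> 2 + 1)) else c k j \<alpha> * (sin t ^ \<alpha> 1 * cos t ^ \<alpha> 2))"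
    for k \<alpha> and t :: real
  have cont: "continuous_on (quarter k) (w k \<alpha>)" for k \<alpha>
    unfolding w_def by (cases "j = 1") (auto intro!: continuous_intros)
  define F where "F y = (\<Sum>k=1..4. \<Sum>\<alpha>\<in>multi_indices n m. integral (quarter k) (w k \<alpha>) * reduced_monomial n \<alpha> y)"
    for y
  have "poly_fun (pars n) m F"
    unfolding F_def[abs_def] by (intro poly_fun_sum poly_fun_cmult poly_fun_reduced_monomial n)
  moreover have "melnikov n (perturbation n m c) h j = (if j = 1 then sqrt (2 * h 1) else 1) * F (radial h)"
    if h: "0 < h 1" for h
  proof -
    let ?W = "if j = 1 then sqrt (2 * h 1) else 1"
    have "melnikov n (perturbation n m c) h j = (\<Sum>k=1..4. integral (quarter k)
        (\<lambda>t. \<Sum>\<alpha>\<in>multi_indices n m. w k \<alpha> t * (?W * reduced_monomial n \<alpha> (radial h))))"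
      unfolding melnikov_quarters[of n h, OF n h] melnikov_integrand[OF n j] perturbation_on_orbit[OF n]
    proof (intro sum.cong refl arg_cong[of _ _ "integral _"] ext)
      fix k t
      have o: "unperturbed_orbit n h t 1 = sqrt (2 * h 1) * sin t"
        "unperturbed_orbit n h t 2 = sqrt (2 * h 1) * cos t"
        using n by (simp_all add: unperturbed_orbit_def)
      show "(if j = 1
          then unperturbed_orbit n h t 1 * (\<Sum>\<alpha>\<in>multi_indices n m. c k 1 \<alpha> * (sin t ^ \<alpha> 1 * cos t ^ \<alpha> 2) * reduced_monomial n \<alpha> (radial h))
             + unperturbed_orbit n h t 2 * (\<Sum>\<alpha>\<in>multi_indices n m. c k 2 \<alpha> * (sin t ^ \<alpha> 1 * cos t ^ \<alpha> 2) * reduced_monomial n \<alpha> (radial h))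
          else (\<Sum>\<alpha>\<in>multi_indices n m. c k j \<alpha> * (sin t ^ \<alpha> 1 * cos t ^ \<alpha> 2) * reduced_monomial n \<alpha> (radial h)))
        = (\<Sum>\<alpha>\<in>multi_indices n m. w k \<alpha> t * (?W * reduced_monomial n \<alpha> (radial h)))"
        unfolding o by (auto simp: w_def sum_distrib_left algebra_simps simp flip: sum.distrib intro!: sum.cong)
    qed
    also have "\<dots> = (\<Sum>k=1..4. \<Sum>\<alpha>\<in>multi_indices n m.
        integral (quarter k) (w k \<alpha>) * (?W * reduced_monomial n \<alpha> (radial h)))"
    proof (intro sum.cong refl)
      fix k
      have int: "w k \<alpha> integrable_on quarter k" for \<alpha>
        using cont[of k \<alpha>] unfolding quarter_def by (rule integrable_continuous_real)
      show "integral (quarter k) (\<lambda>t. \<Sum>\<alpha>\<in>multi_indices n m. w k \<alpha> t * (?W * reduced_monomial n \<alpha> (radial h)))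
        = (\<Sum>\<alpha>\<in>multi_indices n m. integral (quarter k) (w k \<alpha>) * (?W * reduced_monomial n \<alpha> (radial h)))"
        by (subst integral_sum) (auto simp: finite_multi_indices intro!: integrable_on_mult_left int)
    qed
    also have "\<dots> = ?W * F (radial h)"
      by (simp add: F_def sum_distrib_left algebra_simps)
    finally show ?thesis .
  qed
  ultimately show ?thesis by blast
qed

section \<open>Nondegeneracy and the bound on the number of zeros\<close>

text \<open>The adjugate applied to the right-hand side and divided by the determinant is a
  solution.\<close>

lemma det_nonzero_solvable:
  fixes a :: "nat \<Rightarrow> nat \<Rightarrow> real"
  assumes "Determinant.det (Matrix.mat N N (\<lambda>(p, q). a p q)) \<noteq> 0"
  shows "\<exists>x. \<forall>p<N. (\<Sum>q=0..<N. a p q * x q) = v p"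
proof -
  define A where "A = Matrix.mat N N (\<lambda>(p, q). a p q)"
  have A: "A \<in> carrier_mat N N" by (simp add: A_def)
  note adj = adj_mat[OF A]
  define y where "y = adj_mat A *\<^sub>v Matrix.vec N v"
  have y: "y \<in> carrier_vec N" using adj(1) by (simp add: y_def)
  have eq: "A *\<^sub>v y = Determinant.det A \<cdot>\<^sub>v Matrix.vec N v"
  proof -
    have "A *\<^sub>v y = (A * adj_mat A) *\<^sub>v Matrix.vec N v"
      unfolding y_def using A adj(1) by (simp add: assoc_mult_mat_vec)
    also have "\<dots> = Determinant.det A \<cdot>\<^sub>v (1\<^sub>m N *\<^sub>v Matrix.vec N v)"
      unfolding adj(2) by (rule eq_vecI) (auto simp: row_smult)
    finally show ?thesis by simp
  qed
  have "(\<Sum>q=0..<N. a p q * (vec_index y q / Determinant.det A)) = v p" if p: "p < N" for p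
  proof -
    have "(\<Sum>q=0..<N. a p q * vec_index y q) = vec_index (A *\<^sub>v y) p"
      using p y by (simp add: A_def scalar_prod_def)
    also have "\<dots> = Determinant.det A * v p" using p by (simp add: eq)
    finally show ?thesis using assms
      by (simp add: A_def[symmetric] sum_divide_distrib[symmetric] times_divide_eq_right[symmetric] del: times_divide_eq_right)
        (simp add: sum_divide_distrib[symmetric])
  qed
  then show ?thesis by (intro exI[of _ "\<lambda>q. vec_index y q / Determinant.det A"]) blast
qed

lemma card_pars: "2 \<le> n \<Longrightarrow> card (pars n) = n - 1"
  using bij_betw_same_card[OF bij_betw_par] by fastforce

lemma finite_pars: "finite (pars n)"
  by (simp add: pars_def)

text \<open>At a zero of \<open>F\<close> the product rule leaves only the derivative of
  \<open>F\<close>, so an entry of the Melnikov Jacobian is one for \<open>F\<close> times nonzero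
  factors of its row and its column. The column factor for \<open>q = 1\<close> is the derivative of
  \<open>sqrt (2 * h 1)\<close>.\<close>

lemma partial_deriv_melnikov_at_zero:
  assumes F: "\<And>h. 0 < h 1 \<Longrightarrow> melnikov n g h p = (if p = 1 then sqrt (2 * h 1) else 1) * F (radial h)"
    and G: "\<And>c c' t. (\<forall>i\<in>pars n. ((\<lambda>s::real. c s i) has_real_derivative c' i) (at t)) \<Longrightarrow> c t = radial h \<Longrightarrow>
           ((\<lambda>s. F (c s)) has_real_derivative (\<Sum>i\<in>pars n. G i * c' i)) (at t)"
    and h: "0 < h 1" and zero: "F (radial h) = 0" and q: "q \<in> pars n"
  shows "partial_deriv (\<lambda>h. melnikov n g h p) q h =
    (if p = 1 then sqrt (2 * h 1) else 1) * (G q * (if q = 1 then 1 / sqrt (2 * h 1) else 1))"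
proof -
  let ?\<kappa> = "if q = 1 then 1 / sqrt (2 * h 1) else 1"
  define W where "W s = (if p = 1 then sqrt (2 * (h(q := s)) 1) else 1)" for s
  define c where "c s = radial (h(q := s))" for s
  have c: "((\<lambda>s. c s i) has_real_derivative (if i = q then ?\<kappa> else 0)) (at (h q))" for i
  proof (cases "i = q")
    case True
    then show ?thesis using h by (auto simp: c_def radial_def field_simps intro!: derivative_eq_intros)
  next
    case False
    then have "(\<lambda>s. c s i) = (\<lambda>_. radial h i)" by (auto simp: c_def radial_def)
    then show ?thesis using False by simp
  qed
  have dF: "((\<lambda>s. F (c s)) has_real_derivative G q * ?\<kappa>) (at (h q))"
    by (rule DERIV_cong[OF G[of c "\<lambda>i. if i = q then ?\<kappa> else 0"]])
      (use c q finite_pars[of n] in \<open>auto simp: c_def if_distrib[of "(*) _"] cong: if_cong\<close>)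
  \<comment> \<open>Only the existence of this derivative is used; it gets multiplied by
    \<open>F (radial h) = 0\<close>.\<close>
  have "\<exists>W'. (W has_real_derivative W') (at (h q))"
  proof (cases "p = 1 \<and> q = 1")
    case True
    then have "(W has_real_derivative 1 / sqrt (2 * h 1)) (at (h q))"
      using h by (auto simp: W_def[abs_def] field_simps intro!: derivative_eq_intros)
    then show ?thesis ..
  next
    case False
    then have "W = (\<lambda>_. W (h q))" by (auto simp: W_def)
    then show ?thesis by (metis DERIV_const)
  qed
  then obtain W' where "(W has_real_derivative W') (at (h q))" ..
  from DERIV_mult[OF this dF] have d: "((\<lambda>s. W s * F (c s)) has_real_derivative W (h q) * (G q * ?\<kappa>)) (at (h q))"
    using zero by (simp add: c_def mult.commute)
  have "((\<lambda>s. melnikov n g (h(q := s)) p) has_real_derivative W (h q) * (G q * ?\<kappa>)) (at (h q))"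
  proof (rule has_field_derivative_transform_within_open[OF d])
    \<comment> \<open>\<open>F\<close> describes the Melnikov function for \<open>0 < h 1\<close>,
      which restricts \<open>s\<close> in the case \<open>q = 1\<close>.\<close>
    show "open (if q = 1 then {0<..} else UNIV :: real set)" by simp
    show "h q \<in> (if q = 1 then {0<..} else UNIV)" using h by simp
    fix s :: real assume "s \<in> (if q = 1 then {0<..} else UNIV)"
    then have "0 < (h(q := s)) 1" using h by auto
    from F[of "h(q := s)", OF this] show "W s * F (c s) = melnikov n g (h(q := s)) p"
      by (simp only: W_def c_def)
  qed
  from DERIV_imp_deriv[OF this] show ?thesis
    by (simp add: partial_deriv_def W_def)
qed

text \<open>Every finite set of simple zeros is bounded first; the uniform bound then gives both
  claims. \<open>radial\<close> carries simple zeros to nondegenerate common zeros of the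
  polynomials \<open>F j\<close>.\<close>

lemma simple_zeros_le:
  assumes n: "2 \<le> n" and m: "1 \<le> m"
  shows "finite (simple_zeros n (perturbation n m c)) \<and>
    card (simple_zeros n (perturbation n m c)) \<le> m ^ (n - 1)"
proof (rule finite_if_finite_subsets_card_bdd)
  let ?g = "perturbation n m c"
  fix Z assume Z: "Z \<subseteq> simple_zeros n ?g" "finite Z"
  have Zpos: "0 < h 1" and Zext: "h \<in> extensional (pars n)" if "h \<in> Z" for h
    using Z that by (auto simp: simple_zeros_def annulus_def PiE_def)
  have "\<forall>j\<in>pars n. \<exists>F. poly_fun (pars n) m F \<and> (\<forall>h. 0 < h 1 \<longrightarrow>
    melnikov n ?g h j = (if j = 1 then sqrt (2 * h 1) else 1) * F (radial h))"
    using melnikov_eq_poly_fun[OF n] by blast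
  from bchoice[OF this] obtain F where
    F: "\<And>j. j \<in> pars n \<Longrightarrow> poly_fun (pars n) m (F j)" and
    mel: "\<And>j h. j \<in> pars n \<Longrightarrow> 0 < h 1 \<Longrightarrow>
      melnikov n ?g h j = (if j = 1 then sqrt (2 * h 1) else 1) * F j (radial h)" by blast
  have zero: "F j (radial h) = 0" if "h \<in> Z" "j \<in> pars n" for h j
    using mel[of j h, OF that(2) Zpos[OF that(1)]] Zpos[OF that(1)] Z that
    by (auto simp: simple_zeros_def split: if_splits)
  have inj: "inj_on radial Z"
  proof (rule inj_onI)
    fix h h' assume hh: "h \<in> Z" "h' \<in> Z" "radial h = radial h'"
    have "h i = h' i" for i
      using fun_cong[OF hh(3), of i] by (cases "i = 1") (auto simp: radial_def)
    then show "h = h'" by auto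
  qed
  have "card (radial ` Z) \<le> m ^ card (pars n)"
  proof (rule bezout_nondegenerate_zeros[OF finite_pars _ m F])
    show "finite (radial ` Z)" using Z by simp
    show "F k z = 0" if "z \<in> radial ` Z" "k \<in> pars n" for z k
      using that zero by auto
    \<comment> \<open>Outside \<open>pars n\<close> all parameters take the default value of
      extensional functions, so distinct points differ in some coordinate of
      \<open>pars n\<close>.\<close>
    show "\<exists>j\<in>pars n. y j \<noteq> z j" if yz: "y \<in> radial ` Z" "z \<in> radial ` Z" "y \<noteq> z" for y z
    proof (rule ccontr)
      assume "\<not> ?thesis"
      moreover have "y j = z j" if "j \<notin> pars n" for j
      proof -
        obtain h h' where "h \<in> Z" "h' \<in> Z" "y = radial h" "z = radial h'" using yz(1,2) by blast
        moreover have "j \<noteq> 1" using that by (auto simp: pars_def)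
        ultimately show ?thesis
          using that extensional_arb[OF Zext, of h j] extensional_arb[OF Zext, of h' j] by (simp add: radial_def)
      qed
      ultimately have "y j = z j" for j by blast
      then show False using yz(3) by (simp add: fun_eq_iff)
    qed
    fix z v assume "z \<in> radial ` Z"
    then obtain h where h: "h \<in> Z" "z = radial h" by auto
    note pos = Zpos[OF h(1)]
    have "\<forall>p\<in>pars n. \<exists>G. \<forall>c c' t. (\<forall>i\<in>pars n. ((\<lambda>s::real. c s i) has_real_derivative c' i) (at t)) \<longrightarrow>
        c t = z \<longrightarrow> ((\<lambda>s. F p (c s)) has_real_derivative (\<Sum>i\<in>pars n. G i * c' i)) (at t)"
      using poly_fun_gradient[OF F finite_pars] by blast
    from bchoice[OF this] obtain G where
      G: "\<And>p c c' t. p \<in> pars n \<Longrightarrow> (\<forall>i\<in>pars n. ((\<lambda>s::real. c s i) has_real_derivative c' i) (at t)) \<Longrightarrow>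
        c t = z \<Longrightarrow> ((\<lambda>s. F p (c s)) has_real_derivative (\<Sum>i\<in>pars n. G p i * c' i)) (at t)"
      by blast
    define W where "W p = (if p = 1 then sqrt (2 * h 1) else 1)" for p :: nat
    define \<kappa> where "\<kappa> q = (if q = 1 then 1 / sqrt (2 * h 1) else 1)" for q :: nat
    have W: "W p \<noteq> 0" for p using pos by (simp add: W_def)
    have par: "par q \<in> pars n" if "q < n - 1" for q
      using bij_betw_apply[OF bij_betw_par[OF n]] that by simp
    have entry: "partial_deriv (\<lambda>h. melnikov n ?g h (par p)) (par q) h
        = W (par p) * (G (par p) (par q) * \<kappa> (par q))" if "p < n - 1" "q < n - 1" for p q
      unfolding W_def \<kappa>_def
      by (rule partial_deriv_melnikov_at_zero[where F = "F (par p)"])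
        (use that par pos zero h G mel in auto)
    have "melnikov_jacobian n ?g h = Matrix.mat (n - 1) (n - 1)
        (\<lambda>(p, q). W (par p) * (G (par p) (par q) * \<kappa> (par q)))"
      unfolding melnikov_jacobian_def by (rule eq_matI) (auto simp: entry)
    moreover have "Determinant.det (melnikov_jacobian n ?g h) \<noteq> 0"
      using Z h by (auto simp: simple_zeros_def)
    ultimately obtain x where x: "\<forall>p<n - 1. (\<Sum>q=0..<n - 1. W (par p) * (G (par p) (par q) * \<kappa> (par q)) * x q)
        = W (par p) * v (par p)"
      using det_nonzero_solvable[of "n - 1" _ "\<lambda>p. W (par p) * v (par p)"] by fastforce
    \<comment> \<open>\<open>x\<close> solves the system for the Melnikov Jacobian. Scaling by
      \<open>\<kappa>\<close> converts it to the radial coordinate; the index of \<open>x\<close>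
      inverts \<open>par\<close>.\<close>
    define u where "u j = \<kappa> j * x (if j = 1 then 0 else j - 2)" for j
    have u: "u (par q) = \<kappa> (par q) * x q" for q by (simp add: u_def par_def)
    show "\<exists>u. \<forall>k\<in>pars n. ((\<lambda>\<tau>. F k (\<lambda>j. z j + \<tau> * u j)) has_real_derivative v k) (at 0)"
    proof (intro exI[of _ u] ballI)
      fix k assume k: "k \<in> pars n"
      then obtain p where p: "p < n - 1" "k = par p"
        using bij_betw_imp_surj_on[OF bij_betw_par[OF n]] by force
      have "W k * (\<Sum>i\<in>pars n. G k i * u i) = (\<Sum>q=0..<n - 1. W k * (G k (par q) * u (par q)))"
        by (simp add: sum_distrib_left flip: sum.reindex_bij_betw[OF bij_betw_par[OF n]])
      also have "\<dots> = W k * v k"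
        using x p by (simp add: u mult.assoc)
      finally have "(\<Sum>i\<in>pars n. G k i * u i) = v k" using W[of k] by simp
      moreover have "((\<lambda>\<tau>. F k (\<lambda>j. z j + \<tau> * u j)) has_real_derivative (\<Sum>i\<in>pars n. G k i * u i)) (at 0)"
        by (rule G[OF k]) (auto intro!: derivative_eq_intros)
      ultimately show "((\<lambda>\<tau>. F k (\<lambda>j. z j + \<tau> * u j)) has_real_derivative v k) (at 0)" by simp
    qed
  qed
  then show "card Z \<le> m ^ (n - 1)" using card_image[OF inj] card_pars[OF n] by simp
qed

section \<open>A perturbation with an explicitly solvable flow\<close>

definition example_coeff :: "nat \<Rightarrow> nat \<Rightarrow> (nat \<Rightarrow> nat) \<Rightarrow> real" where
  "example_coeff k i \<alpha> =
    (if k = 1 \<and> i = 1 then (if \<alpha> = (\<lambda>_. 0) then 1 else 0)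
     else if k = 2 \<or> 3 \<le> i then (if \<alpha> = (\<lambda>j. if j = i then 1 else 0) then - 1 else 0)
     else 0)"

definition example_field :: "nat \<Rightarrow> nat \<Rightarrow> nat \<Rightarrow> (nat \<Rightarrow> real) \<Rightarrow> real" where
  "example_field n = perturbation n 1 example_coeff"

lemma example_field:
  assumes i: "i \<in> {1..n}"
  shows "example_field n k i x =
    (if k = 1 \<and> i = 1 then 1 else if k = 2 \<or> 3 \<le> i then - x i else 0)"
proof -
  let ?u = "\<lambda>j. if j = i then 1 else 0 :: nat"
  have "(\<lambda>_. 0) \<in> multi_indices n 1" "?u \<in> multi_indices n 1"
    using i by (auto simp: multi_indices_def)
  moreover have "(\<Prod>j=1..n. x j ^ ?u j) = x i"
  proof -
    have "(\<Prod>j=1..n. x j ^ ?u j) = (\<Prod>j=1..n. if j = i then x j else 1)"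
      by (rule prod.cong) auto
    then show ?thesis using i by simp
  qed
  ultimately show ?thesis
    using finite_multi_indices[of n 1]
    by (cases "k = 1 \<and> i = 1"; cases "k = 2 \<or> 3 \<le> i")
      (auto simp: example_field_def perturbation_def example_coeff_def if_distrib[of "\<lambda>c. c * _"] cong: if_cong)
qed

section \<open>Solutions inside a region\<close>

text \<open>\<open>p\<close> and \<open>q\<close> undo the rotation and the decay; their derivatives
  are zero, so they are constant. Continuity covers the end points, where no derivative is assumed.
  Since the formula holds for every solution, it yields uniqueness; \<open>\<delta> = 0\<close>
  gives the plain rotations.\<close>

lemma spiral_solution:
  fixes u w :: "real \<Rightarrow> real"
  assumes cont: "continuous_on {a..b} u" "continuous_on {a..b} w"
    and du: "\<And>s. s \<in> {a<..<b} \<Longrightarrow> (u has_real_derivative w s - \<delta> * u s) (at s)"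
    and dw: "\<And>s. s \<in> {a<..<b} \<Longrightarrow> (w has_real_derivative - u s - \<delta> * w s) (at s)"
    and t: "t \<in> {a..b}"
  shows "u t = exp (- \<delta> * (t - a)) * (u a * cos (t - a) + w a * sin (t - a))"
    and "w t = exp (- \<delta> * (t - a)) * (w a * cos (t - a) - u a * sin (t - a))"
proof -
  define p where "p s = exp (\<delta> * (s - a)) * (u s * cos (s - a) - w s * sin (s - a))" for s
  define q where "q s = exp (\<delta> * (s - a)) * (u s * sin (s - a) + w s * cos (s - a))" for s
  have const: "p t = u a \<and> q t = w a"
  proof (cases "t = a")
    case False
    with t have "a < t" by simp
    have cont': "continuous_on {a..t} u" "continuous_on {a..t} w"
      using cont t by (auto elim: continuous_on_subset)
    have "continuous_on {a..t} p" "continuous_on {a..t} q"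
      unfolding p_def q_def by (intro continuous_intros cont')+
    moreover have "(p has_real_derivative 0) (at s)" "(q has_real_derivative 0) (at s)"
      if "a < s" "s < t" for s
    proof -
      have s: "s \<in> {a<..<b}" using that t by simp
      show "(p has_real_derivative 0) (at s)" "(q has_real_derivative 0) (at s)"
        unfolding p_def q_def
        by (rule derivative_eq_intros du[OF s] dw[OF s] refl | simp add: algebra_simps)+
    qed
    ultimately have "p t = p a" "q t = q a"
      using DERIV_isconst_end[OF \<open>a < t\<close>] by blast+
    then show ?thesis by (simp add: p_def q_def)
  qed (simp add: p_def q_def)
  define E where "E = exp (\<delta> * (t - a))"
  have E: "exp (- \<delta> * (t - a)) = 1 / E" "E \<noteq> 0" by (simp_all add: E_def exp_minus[symmetric] inverse_eq_divide[symmetric])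
  define S C where "S = sin (t - a)" and "C = cos (t - a)"
  have sc: "S * S + C * C = 1"
    using sin_cos_squared_add[of "t - a"] by (simp add: S_def C_def power2_eq_square)
  have pq: "u a = E * (u t * C - w t * S)" "w a = E * (u t * S + w t * C)"
    using const by (simp_all add: p_def q_def E_def S_def C_def)
  have "u a * C + w a * S = E * u t * (S * S + C * C)" "w a * C - u a * S = E * w t * (S * S + C * C)"
    unfolding pq by (simp_all add: algebra_simps)
  then show "u t = exp (- \<delta> * (t - a)) * (u a * cos (t - a) + w a * sin (t - a))"
    "w t = exp (- \<delta> * (t - a)) * (w a * cos (t - a) - u a * sin (t - a))"
    unfolding E(1) sc S_def[symmetric] C_def[symmetric] using E(2) by simp_all
qed

lemma decay_solution:
  fixes u :: "real \<Rightarrow> real"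
  assumes cont: "continuous_on {a..b} u"
    and du: "\<And>s. s \<in> {a<..<b} \<Longrightarrow> (u has_real_derivative - \<delta> * u s) (at s)"
    and t: "t \<in> {a..b}"
  shows "u t = exp (- \<delta> * (t - a)) * u a"
proof (cases "t = a")
  case False
  with t have "a < t" by simp
  define p where "p s = exp (\<delta> * (s - a)) * u s" for s
  have "continuous_on {a..t} u" using cont t by (auto elim: continuous_on_subset)
  then have "continuous_on {a..t} p" unfolding p_def by (intro continuous_intros)
  moreover have "(p has_real_derivative 0) (at s)" if "a < s" "s < t" for s
  proof -
    have s: "s \<in> {a<..<b}" using that t by simp
    show ?thesis unfolding p_def
      by (rule derivative_eq_intros du[OF s] refl | simp add: algebra_simps)+
  qed
  ultimately have "p t = p a" using DERIV_isconst_end[OF \<open>a < t\<close>] by blast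
  then have "exp (\<delta> * (t - a)) * u t = u a" by (simp add: p_def)
  moreover have "exp (- \<delta> * (t - a)) * exp (\<delta> * (t - a)) = 1" by (simp flip: exp_add)
  ultimately show ?thesis by (metis mult.assoc mult_1)
qed simp

text \<open>Applied on both sides of a switching time, this shows that a coordinate with opposite
  signs in the two adjacent regions vanishes there.\<close>

lemma nonneg_at_ends:
  fixes f :: "real \<Rightarrow> real"
  assumes "continuous_on {a..b} f" "a < b" "\<And>t. t \<in> {a<..<b} \<Longrightarrow> 0 \<le> f t"
  shows "0 \<le> f a" "0 \<le> f b"
  using continuous_ge_on_closure[of "{a<..<b}" f _ 0] assms by simp_all

text \<open>This fixes the time spent in each of the regions 2, 3 and 4 to a quarter turn: the
  coordinate that vanishes at the exit is a cosine up to a nonzero factor.\<close>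

lemma cos_first_zero:
  assumes "a < b" "\<And>t. t \<in> {a<..<b} \<Longrightarrow> 0 < cos (t - a)" "cos (b - a) = 0"
  shows "b = a + pi / 2"
proof (rule ccontr)
  assume ne: "b \<noteq> a + pi / 2"
  show False
  proof (cases "b < a + pi / 2")
    case True
    then have "0 < cos (b - a)" using assms(1) by (intro cos_gt_zero) auto
    then show False using assms(3) by simp
  next
    case False
    then have "0 < cos (a + pi / 2 - a)" using ne by (intro assms(2)) auto
    then show False by simp
  qed
qed

section \<open>The explicit periodic orbit and its uniqueness\<close>

definition amplitude :: "real \<Rightarrow> real" where
  "amplitude \<epsilon> = 2 * \<epsilon> / (exp (pi * \<epsilon>) - 1)"

text \<open>The time at which the circle of radius \<open>amplitude \<epsilon> + \<epsilon>\<close>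
  about \<open>(0, - \<epsilon>)\<close>, followed clockwise from its top, reaches
  \<open>x 2 = 0\<close>.\<close>

definition first_switch :: "real \<Rightarrow> real" where
  "first_switch \<epsilon> = arccos (\<epsilon> / (amplitude \<epsilon> + \<epsilon>))"

definition later_radius :: "real \<Rightarrow> real \<Rightarrow> real" where
  "later_radius \<epsilon> s = amplitude \<epsilon> * (if s \<le> pi / 2 then exp (\<epsilon> * (pi / 2 - s)) else 1)"

text \<open>
  Below, \<open>amplitude \<epsilon>\<close> is the value of \<open>x\<^sub>2\<close> at the starting point, and \<open>later_radius \<epsilon> s\<close> the distance
  from \<open>{x\<^sub>1 = x\<^sub>2 = 0}\<close> at time \<open>s\<close> after the orbit has left region 1.
\<close>

definition example_orbit :: "nat \<Rightarrow> real \<Rightarrow> real \<Rightarrow> nat \<Rightarrow> real" where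
  "example_orbit n \<epsilon> t = (\<lambda>i\<in>{1..n}.
     if i = 1 then (if t \<le> first_switch \<epsilon> then (amplitude \<epsilon> + \<epsilon>) * sin t
                    else later_radius \<epsilon> (t - first_switch \<epsilon>) * cos (t - first_switch \<epsilon>))
     else if i = 2 then (if t \<le> first_switch \<epsilon> then (amplitude \<epsilon> + \<epsilon>) * cos t - \<epsilon>
                    else - later_radius \<epsilon> (t - first_switch \<epsilon>) * sin (t - first_switch \<epsilon>))
     else 0)"

lemma amplitude_pos: "0 < \<epsilon> \<Longrightarrow> 0 < amplitude \<epsilon>"
  by (simp add: amplitude_def)

text \<open>The fixed point equation of the return map. The circle through
  \<open>(0, \<rho>)\<close> about \<open>(0, - \<epsilon>)\<close> meets the axis
  \<open>x 2 = 0\<close> at a distance from the origin whose square is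
  \<open>(\<rho> + \<epsilon>)\<^sup>2 - \<epsilon>\<^sup>2\<close>; region 2 then shrinks the
  distance by \<open>exp (- \<epsilon> * (pi / 2))\<close>. One factor \<open>\<rho>\<close> cancels
  and a linear equation remains.\<close>

lemma amplitude_eq_iff:
  assumes "0 < \<epsilon>" "0 < \<rho>"
  shows "\<rho> = amplitude \<epsilon> \<longleftrightarrow> (\<rho> + \<epsilon>)\<^sup>2 - \<epsilon>\<^sup>2 = (\<rho> * exp (\<epsilon> * (pi / 2)))\<^sup>2"
proof -
  have e: "1 < exp (pi * \<epsilon>)" using assms by simp
  have ee: "(exp (\<epsilon> * (pi / 2)))\<^sup>2 = exp (pi * \<epsilon>)"
    by (simp add: exp_double[symmetric] mult.commute)
  have "(\<rho> * exp (\<epsilon> * (pi / 2)))\<^sup>2 - ((\<rho> + \<epsilon>)\<^sup>2 - \<epsilon>\<^sup>2)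
      = \<rho> * (\<rho> * (exp (pi * \<epsilon>) - 1)) - \<rho> * (2 * \<epsilon>)"
    unfolding power_mult_distrib ee by (simp add: power2_eq_square algebra_simps)
  then have "(\<rho> + \<epsilon>)\<^sup>2 - \<epsilon>\<^sup>2 = (\<rho> * exp (\<epsilon> * (pi / 2)))\<^sup>2 \<longleftrightarrow> \<rho> * (\<rho> * (exp (pi * \<epsilon>) - 1)) = \<rho> * (2 * \<epsilon>)"
    by linarith
  also have "\<dots> \<longleftrightarrow> \<rho> * (exp (pi * \<epsilon>) - 1) = 2 * \<epsilon>" using assms by simp
  also have "\<dots> \<longleftrightarrow> \<rho> = amplitude \<epsilon>"
    unfolding amplitude_def by (subst eq_divide_eq) (use e assms in simp)
  finally show ?thesis by simp
qed

text \<open>The last two identities make \<open>example_orbit\<close> continuous at the switch; the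
  last one is the fixed point equation combined with Pythagoras.\<close>

lemma first_switch:
  assumes "0 < \<epsilon>"
  shows "0 < first_switch \<epsilon>" "first_switch \<epsilon> < pi / 2"
    "(amplitude \<epsilon> + \<epsilon>) * cos (first_switch \<epsilon>) = \<epsilon>"
    "(amplitude \<epsilon> + \<epsilon>) * sin (first_switch \<epsilon>) = amplitude \<epsilon> * exp (\<epsilon> * (pi / 2))"
proof -
  let ?R = "amplitude \<epsilon> + \<epsilon>"
  have R: "0 < ?R" "0 < \<epsilon> / ?R" "\<epsilon> / ?R < 1" using assms amplitude_pos[OF assms] by simp_all
  show pos: "0 < first_switch \<epsilon>" unfolding first_switch_def using R arccos_lt_bounded[of "\<epsilon> / ?R"] by linarith
  show lt: "first_switch \<epsilon> < pi / 2" unfolding first_switch_def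
    using R arccos_less_arccos[of 0 "\<epsilon> / ?R"] by simp
  have c: "cos (first_switch \<epsilon>) = \<epsilon> / ?R" unfolding first_switch_def
    using R by (intro cos_arccos) linarith+
  then show c': "?R * cos (first_switch \<epsilon>) = \<epsilon>" using R by simp
  have "(?R * sin (first_switch \<epsilon>))\<^sup>2 = ?R\<^sup>2 - (?R * cos (first_switch \<epsilon>))\<^sup>2"
    by (simp only: power_mult_distrib sin_squared_eq right_diff_distrib mult_1_right)
  also have "\<dots> = (amplitude \<epsilon> * exp (\<epsilon> * (pi / 2)))\<^sup>2"
    using amplitude_eq_iff[OF assms amplitude_pos[OF assms]] c' by simp
  finally show "?R * sin (first_switch \<epsilon>) = amplitude \<epsilon> * exp (\<epsilon> * (pi / 2))"
    using pos lt R amplitude_pos[OF assms] sin_gt_zero[of "first_switch \<epsilon>"]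
    by (simp add: power2_eq_iff_nonneg)
qed

lemma example_vfield:
  assumes "i \<in> {1..n}"
  shows "vfield (example_field n) \<epsilon> k x i =
    (if i = 1 then x 2 + (if k = 1 then \<epsilon> else if k = 2 then - \<epsilon> * x 1 else 0)
     else if i = 2 then - x 1 + (if k = 2 then - \<epsilon> * x 2 else 0) else - \<epsilon> * x i)"
  using assms unfolding vfield_def example_field[OF assms] by auto

text \<open>The solution is followed through the four regions, where the flow is explicit. Each
  switching time is found from a vanishing coordinate, and closing after one turn gives the fixed
  point equation for \<open>x 0 2\<close>.\<close>

lemma example_periodic_solution_unique:
  assumes n: "2 \<le> n" and \<epsilon>: "0 < \<epsilon>"
    and per: "one_turn_periodic n (example_field n) \<epsilon> x T"
  shows "T = first_switch \<epsilon> + 3 * (pi / 2)" "\<forall>t\<in>{0..T}. x t = example_orbit n \<epsilon> t"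
proof -
  let ?g = "example_field n"
  from per obtain \<tau> where pts: "\<And>t. t \<in> {0..T} \<Longrightarrow> x t \<in> points n"
    and cont: "\<And>i. i \<in> {1..n} \<Longrightarrow> continuous_on {0..T} (\<lambda>t. x t i)"
    and start: "x 0 1 = 0" "x 0 2 > 0" "x T = x 0" and \<tau>: "\<tau> 0 = 0" "\<tau> 4 = T"
    and piece: "\<forall>k\<in>{1..4}. \<tau> (k - 1) < \<tau> k \<and>
        (\<forall>t\<in>{\<tau> (k - 1)<..<\<tau> k}. x t \<in> region k \<and>
          (\<forall>i\<in>{1..n}. ((\<lambda>s. x s i) has_real_derivative vfield ?g \<epsilon> k (x t) i) (at t)))"
    unfolding one_turn_periodic_def by blast
  define a b c where "a = \<tau> 1" and "b = \<tau> 2" and "c = \<tau> 3"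
  have p1: "0 < a" "\<And>t. t \<in> {0<..<a} \<Longrightarrow> x t \<in> region 1"
    "\<And>t i. t \<in> {0<..<a} \<Longrightarrow> i \<in> {1..n} \<Longrightarrow> ((\<lambda>s. x s i) has_real_derivative vfield ?g \<epsilon> 1 (x t) i) (at t)"
    using bspec[OF piece, of 1] \<tau> by (auto simp: a_def)
  have p2: "a < b" "\<And>t. t \<in> {a<..<b} \<Longrightarrow> x t \<in> region 2"
    "\<And>t i. t \<in> {a<..<b} \<Longrightarrow> i \<in> {1..n} \<Longrightarrow> ((\<lambda>s. x s i) has_real_derivative vfield ?g \<epsilon> 2 (x t) i) (at t)"
    using bspec[OF piece, of 2] by (auto simp: a_def b_def)
  have p3: "b < c" "\<And>t. t \<in> {b<..<c} \<Longrightarrow> x t \<in> region 3"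
    "\<And>t i. t \<in> {b<..<c} \<Longrightarrow> i \<in> {1..n} \<Longrightarrow> ((\<lambda>s. x s i) has_real_derivative vfield ?g \<epsilon> 3 (x t) i) (at t)"
    using bspec[OF piece, of 3] by (auto simp: c_def b_def)
  have p4: "c < T" "\<And>t. t \<in> {c<..<T} \<Longrightarrow> x t \<in> region 4"
    "\<And>t i. t \<in> {c<..<T} \<Longrightarrow> i \<in> {1..n} \<Longrightarrow> ((\<lambda>s. x s i) has_real_derivative vfield ?g \<epsilon> 4 (x t) i) (at t)"
    using bspec[OF piece, of 4] \<tau> by (auto simp: c_def)
  note order = p1(1) p2(1) p3(1) p4(1)
  have i12: "1 \<in> {1..n}" "2 \<in> {1..n}" using n by auto
  have cont': "continuous_on {s..t} (\<lambda>t. x t i)" if "i \<in> {1..n}" "0 \<le> s" "t \<le> T" for s t i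
    using cont[OF that(1)] by (rule continuous_on_subset) (use that in auto)
  define \<rho> R where "\<rho> = x 0 2" and "R = \<rho> + \<epsilon>"
  have R: "0 < R" "\<epsilon> < R" using start \<epsilon> by (simp_all add: R_def \<rho>_def)

  have sol1: "x t 1 = R * sin t" "x t 2 = R * cos t - \<epsilon>" if "t \<in> {0..a}" for t
  proof -
    \<comment> \<open>In region 1 the pair \<open>x 1\<close>, \<open>x 2 + \<epsilon>\<close>
      rotates without decay.\<close>
    have c1: "continuous_on {0..a} (\<lambda>t. x t 1)" and c2: "continuous_on {0..a} (\<lambda>t. x t 2 + \<epsilon>)"
      using cont'[OF i12(1), of 0 a] cont'[OF i12(2), of 0 a] order by (auto intro!: continuous_intros)
    have d1: "((\<lambda>t. x t 1) has_real_derivative (x s 2 + \<epsilon>) - 0 * x s 1) (at s)"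
      and d2: "((\<lambda>t. x t 2 + \<epsilon>) has_real_derivative - x s 1 - 0 * (x s 2 + \<epsilon>)) (at s)"
      if "s \<in> {0<..<a}" for s
      using p1(3)[OF that i12(1)] p1(3)[OF that i12(2)] i12
      by (auto simp: example_vfield intro!: derivative_eq_intros)
    show "x t 1 = R * sin t" "x t 2 = R * cos t - \<epsilon>"
      using spiral_solution[OF c1 c2 d1 d2 that] start by (simp_all add: R_def \<rho>_def)
  qed
  have "0 \<le> x a 2"
    using nonneg_at_ends(2)[OF cont'[OF i12(2), of 0 a] p1(1)] p1(2) order by (auto simp: region_def)
  moreover have "0 \<le> - x a 2"
    using nonneg_at_ends(1)[OF continuous_on_minus[OF cont'[OF i12(2), of a b]] p2(1)] p2(2) order
    by (fastforce simp: region_def)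
  ultimately have xa2: "x a 2 = 0" by simp
  then have cosa: "R * cos a = \<epsilon>" using sol1(2)[of a] order by simp
  \<comment> \<open>Just after \<open>pi\<close> the sine, hence \<open>x 1\<close>, would be
    negative inside region 1. The bound selects the right solution of
    \<open>R * cos a = \<epsilon>\<close>.\<close>
  have "a \<le> pi"
  proof (rule ccontr)
    assume "\<not> a \<le> pi"
    then obtain t where t: "pi < t" "t < a" "t < 2 * pi"
      using dense[of pi "min a (2 * pi)"] by auto
    then have "t \<in> {0<..<a}" using pi_gt_zero by simp
    then have "0 \<le> R * sin t" using p1(2)[of t] sol1(1)[of t] by (simp add: region_def)
    moreover have "sin t < 0" using t by (intro sin_lt_zero) auto
    ultimately show False using R by (simp add: zero_le_mult_iff)
  qed
  have a: "a = arccos (\<epsilon> / R)"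
  proof -
    have "cos a = \<epsilon> / R" using cosa R by (simp add: field_simps)
    then show ?thesis using arccos_cos[of a] \<open>a \<le> pi\<close> order by simp
  qed
  define \<sigma> where "\<sigma> = x a 1"
  have \<sigma>: "\<sigma> = R * sin a" using sol1(1)[of a] order by (simp add: \<sigma>_def)
  have "a \<noteq> pi" using cosa R \<epsilon> by auto
  then have \<sigma>pos: "0 < \<sigma>" using \<sigma> R sin_gt_zero[of a] \<open>a \<le> pi\<close> order by simp

  have sol2: "x t 1 = exp (- \<epsilon> * (t - a)) * \<sigma> * cos (t - a)" "x t 2 = - exp (- \<epsilon> * (t - a)) * \<sigma> * sin (t - a)"
    if "t \<in> {a..b}" for t
  proof -
    have c1: "continuous_on {a..b} (\<lambda>t. x t 1)" and c2: "continuous_on {a..b} (\<lambda>t. x t 2)"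
      using cont'[OF i12(1), of a b] cont'[OF i12(2), of a b] order by auto
    have d1: "((\<lambda>t. x t 1) has_real_derivative x s 2 - \<epsilon> * x s 1) (at s)"
      and d2: "((\<lambda>t. x t 2) has_real_derivative - x s 1 - \<epsilon> * x s 2) (at s)"
      if "s \<in> {a<..<b}" for s
      using p2(3)[OF that i12(1)] p2(3)[OF that i12(2)] i12 by (simp_all add: example_vfield)
    show "x t 1 = exp (- \<epsilon> * (t - a)) * \<sigma> * cos (t - a)" "x t 2 = - exp (- \<epsilon> * (t - a)) * \<sigma> * sin (t - a)"
      using spiral_solution[OF c1 c2 d1 d2 that] xa2 by (simp_all add: \<sigma>_def)
  qed
  have "0 \<le> x b 1"
    using nonneg_at_ends(2)[OF cont'[OF i12(1), of a b] p2(1)] p2(2) order by (fastforce simp: region_def)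
  moreover have "0 \<le> - x b 1"
    using nonneg_at_ends(1)[OF continuous_on_minus[OF cont'[OF i12(1), of b c]] p3(1)] p3(2) order
    by (fastforce simp: region_def)
  ultimately have xb1: "x b 1 = 0" by simp
  have b: "b = a + pi / 2"
  proof (rule cos_first_zero[OF p2(1)])
    show "0 < cos (t - a)" if "t \<in> {a<..<b}" for t
      using p2(2)[OF that] sol2(1)[of t] that \<sigma>pos
      by (auto simp: region_def zero_less_mult_iff mult_less_0_iff)
    show "cos (b - a) = 0" using xb1 sol2(1)[of b] \<sigma>pos order by simp
  qed
  \<comment> \<open>The planar distance from the origin on leaving region 2, which regions 3 and 4
    preserve.\<close>
  define \<sigma>' where "\<sigma>' = exp (- \<epsilon> * (pi / 2)) * \<sigma>"
  have \<sigma>'pos: "0 < \<sigma>'" using \<sigma>pos by (simp add: \<sigma>'_def)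
  have xb2: "x b 2 = - \<sigma>'" using sol2(2)[of b] order b by (simp add: \<sigma>'_def)

  have sol34: "x t 1 = x p 1 * cos (t - p) + x p 2 * sin (t - p)" "x t 2 = x p 2 * cos (t - p) - x p 1 * sin (t - p)"
    if t: "t \<in> {p..q}" and pq: "p = b \<and> q = c \<or> p = c \<and> q = T" for t p q
  proof -
    have c1: "continuous_on {p..q} (\<lambda>t. x t 1)" and c2: "continuous_on {p..q} (\<lambda>t. x t 2)"
      using cont'[OF i12(1), of p q] cont'[OF i12(2), of p q] order pq by auto
    have d1: "((\<lambda>t. x t 1) has_real_derivative x s 2 - 0 * x s 1) (at s)"
      and d2: "((\<lambda>t. x t 2) has_real_derivative - x s 1 - 0 * x s 2) (at s)"
      if "s \<in> {p<..<q}" for s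
      using p3(3)[of s 1] p3(3)[of s 2] p4(3)[of s 1] p4(3)[of s 2] i12 that pq by (auto simp: example_vfield)
    show "x t 1 = x p 1 * cos (t - p) + x p 2 * sin (t - p)" "x t 2 = x p 2 * cos (t - p) - x p 1 * sin (t - p)"
      using spiral_solution[OF c1 c2 d1 d2 t] by simp_all
  qed
  have "0 \<le> - x c 2"
    using nonneg_at_ends(2)[OF continuous_on_minus[OF cont'[OF i12(2), of b c]] p3(1)] p3(2) order
    by (fastforce simp: region_def)
  moreover have "0 \<le> x c 2"
    using nonneg_at_ends(1)[OF cont'[OF i12(2), of c T] p4(1)] p4(2) order by (fastforce simp: region_def)
  ultimately have xc2: "x c 2 = 0" by simp
  have c: "c = b + pi / 2"
  proof (rule cos_first_zero[OF p3(1)])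
    show "0 < cos (t - b)" if "t \<in> {b<..<c}" for t
      using p3(2)[OF that] sol34(2)[of t b c] that \<sigma>'pos xb1 xb2 by (simp add: region_def zero_less_mult_iff)
    show "cos (c - b) = 0" using xc2 sol34(2)[of c b c] \<sigma>'pos xb1 xb2 order by simp
  qed
  have xc1: "x c 1 = - \<sigma>'" using sol34(1)[of c b c] order c xb1 xb2 by simp
  have Tc: "T = c + pi / 2"
  proof (rule cos_first_zero[OF p4(1)])
    show "0 < cos (t - c)" if "t \<in> {c<..<T}" for t
      using p4(2)[OF that] sol34(1)[of t c T] that \<sigma>'pos xc1 xc2
      by (auto simp: region_def zero_less_mult_iff)
    show "cos (T - c) = 0" using start sol34(1)[of T c T] \<sigma>'pos xc1 xc2 order by simp
  qed
  \<comment> \<open>The closing condition: after the half circle of radius \<open>\<sigma>'\<close>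
    the orbit is back at height \<open>\<rho>\<close>.\<close>
  have "\<rho> = \<sigma>'" using sol34(2)[of T c T] order Tc xc1 xc2 start by (simp add: \<rho>_def)
  then have \<sigma>_eq: "\<sigma> = \<rho> * exp (\<epsilon> * (pi / 2))" by (simp add: \<sigma>'_def exp_minus)
  have "\<sigma>\<^sup>2 = R\<^sup>2 - (R * cos a)\<^sup>2"
    unfolding \<sigma> by (simp only: power_mult_distrib sin_squared_eq right_diff_distrib mult_1_right)
  then have \<rho>: "\<rho> = amplitude \<epsilon>"
    using amplitude_eq_iff[OF \<epsilon>, of \<rho>] start cosa \<sigma>_eq by (simp add: R_def \<rho>_def)
  have a': "a = first_switch \<epsilon>" by (simp add: a first_switch_def R_def \<rho>)
  show T: "T = first_switch \<epsilon> + 3 * (pi / 2)" using Tc c b a' by simp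

  \<comment> \<open>The components from 3 on obey the same equation in all regions, but only between
    switching times; the last assumption keeps \<open>p\<close> and \<open>q\<close> within one
    piece.\<close>
  have decay: "x q i = exp (- \<epsilon> * (q - p)) * x p i" if "i \<in> {3..n}" "0 \<le> p" "p \<le> q" "q \<le> T"
    "\<exists>p' q'. p' \<le> p \<and> q \<le> q' \<and> (p' = 0 \<and> q' = a \<or> p' = a \<and> q' = b \<or> p' = b \<and> q' = c \<or> p' = c \<and> q' = T)" for p q i
  proof (rule decay_solution)
    have i: "i \<in> {1..n}" using that by auto
    then show "continuous_on {p..q} (\<lambda>t. x t i)" using cont' that by blast
    fix s assume s: "s \<in> {p<..<q}"
    then have "s \<in> {0<..<a} \<or> s \<in> {a<..<b} \<or> s \<in> {b<..<c} \<or> s \<in> {c<..<T}"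
      using that(5) by auto
    then show "((\<lambda>t. x t i) has_real_derivative - \<epsilon> * x s i) (at s)"
      using p1(3)[of s i] p2(3)[of s i] p3(3)[of s i] p4(3)[of s i] i that(1) by (auto simp: example_vfield)
  qed (use that in auto)
  have zero: "x t i = 0" if t: "t \<in> {0..T}" and i: "i \<in> {3..n}" for t i
  proof -
    have 1: "x t i = exp (- \<epsilon> * t) * x 0 i" if "t \<in> {0..a}" for t
      using decay[OF i, of 0 t] that order by auto
    have 2: "x t i = exp (- \<epsilon> * t) * x 0 i" if "t \<in> {a..b}" for t
      using decay[OF i, of a t] 1[of a] that order by (auto simp flip: exp_add simp: algebra_simps mult_exp_exp)
    have 3: "x t i = exp (- \<epsilon> * t) * x 0 i" if "t \<in> {b..c}" for t
      using decay[OF i, of b t] 2[of b] that order by (auto simp flip: exp_add simp: algebra_simps mult_exp_exp)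
    have 4: "x t i = exp (- \<epsilon> * t) * x 0 i" if "t \<in> {c..T}" for t
      using decay[OF i, of c t] 3[of c] that order by (auto simp flip: exp_add simp: algebra_simps mult_exp_exp)
    \<comment> \<open>One turn multiplies the component by this factor, so periodicity forces it to
      be 0.\<close>
    have "exp (- \<epsilon> * T) \<noteq> 1" using \<epsilon> order by simp
    then have "x 0 i = 0" using 4[of T] order start by simp
    then show ?thesis using 1[of t] 2[of t] 3[of t] 4[of t] t by fastforce
  qed

  show "\<forall>t\<in>{0..T}. x t = example_orbit n \<epsilon> t"
  proof
    fix t assume t: "t \<in> {0..T}"
    have x1: "x t 1 = (if t \<le> a then R * sin t else later_radius \<epsilon> (t - a) * cos (t - a))"
      and x2: "x t 2 = (if t \<le> a then R * cos t - \<epsilon> else - later_radius \<epsilon> (t - a) * sin (t - a))"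
    proof -
      consider "t \<in> {0..a}" | "t \<in> {a<..b}" | "t \<in> {b<..c}" | "t \<in> {c<..T}" using t by fastforce
      then have "x t 1 = (if t \<le> a then R * sin t else later_radius \<epsilon> (t - a) * cos (t - a)) \<and>
        x t 2 = (if t \<le> a then R * cos t - \<epsilon> else - later_radius \<epsilon> (t - a) * sin (t - a))"
      proof cases
        case 1 then show ?thesis using sol1[of t] by simp
      next
        case 2
        have "later_radius \<epsilon> (t - a) = exp (- \<epsilon> * (t - a)) * \<sigma>"
          using 2 b by (simp add: later_radius_def \<sigma>_eq \<rho> right_diff_distrib mult_exp_exp)
        then show ?thesis using 2 sol2[of t] by simp
      next
        case 3
        have "sin (t - b) = - cos (t - a)" "cos (t - b) = sin (t - a)"
          using b by (simp_all add: sin_diff cos_diff sin_add cos_add)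
        moreover have "\<not> t \<le> a" using 3 order by auto
        moreover have "\<not> t - a \<le> pi / 2" using 3 b by auto
        ultimately show ?thesis using 3 xb1 xb2 sol34[of t b c] \<open>\<rho> = \<sigma>'\<close> \<rho> by (simp add: later_radius_def)
      next
        case 4
        have "t - c = (t - a) - pi" using c b by simp
        then have "sin (t - c) = - sin (t - a)" "cos (t - c) = - cos (t - a)" by (simp_all only: sin_minus_pi cos_minus_pi)
        moreover have "\<not> t \<le> a" using 4 order by auto
        moreover have "\<not> t - a \<le> pi / 2" using 4 order b by auto
        ultimately show ?thesis using 4 xc1 xc2 sol34[of t c T] \<open>\<rho> = \<sigma>'\<close> \<rho> by (simp add: later_radius_def)
      qed
      then show "x t 1 = (if t \<le> a then R * sin t else later_radius \<epsilon> (t - a) * cos (t - a))"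
        "x t 2 = (if t \<le> a then R * cos t - \<epsilon> else - later_radius \<epsilon> (t - a) * sin (t - a))" by auto
    qed
    show "x t = example_orbit n \<epsilon> t"
    proof
      fix i
      consider "i \<notin> {1..n}" | "i = 1" | "i = 2" | "i \<in> {3..n}" by fastforce
      then show "x t i = example_orbit n \<epsilon> t i"
      proof cases
        case 1 then show ?thesis using pts[OF t] by (auto simp: points_def example_orbit_def PiE_def extensional_def)
      next
        case 2 then show ?thesis using x1 n by (simp add: example_orbit_def a' R_def \<rho>)
      next
        case 3 then show ?thesis using x2 n by (simp add: example_orbit_def a' R_def \<rho>)
      next
        case 4 then show ?thesis using zero[OF t] by (simp add: example_orbit_def)
      qed
    qed
  qed
qed

lemma later_radius_bounds:
  assumes "0 < \<epsilon>" "0 \<le> s"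
  shows "amplitude \<epsilon> \<le> later_radius \<epsilon> s" "later_radius \<epsilon> s \<le> amplitude \<epsilon> * exp (\<epsilon> * (pi / 2))"
  using assms amplitude_pos[of \<epsilon>] by (auto simp: later_radius_def)

text \<open>Near each time between two switches the orbit agrees with a smooth formula, which is
  differentiated. Continuity at the first switch comes from the identities in
  \<open>first_switch\<close>.\<close>

lemma example_orbit_periodic:
  assumes n: "2 \<le> n" and \<epsilon>: "0 < \<epsilon>"
  shows "one_turn_periodic n (example_field n) \<epsilon> (example_orbit n \<epsilon>) (first_switch \<epsilon> + 3 * (pi / 2))"
proof -
  let ?x = "example_orbit n \<epsilon>" and ?a = "first_switch \<epsilon>" and ?\<rho> = "amplitude \<epsilon>"
  let ?\<sigma> = "?\<rho> * exp (\<epsilon> * (pi / 2))"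
  define T where "T = ?a + 3 * (pi / 2)"
  note fs = first_switch[OF \<epsilon>] and \<rho> = amplitude_pos[OF \<epsilon>]
  have i12: "1 \<in> {1..n}" "2 \<in> {1..n}" using n by auto
  have x1: "?x t 1 = (if t \<le> ?a then (?\<rho> + \<epsilon>) * sin t else later_radius \<epsilon> (t - ?a) * cos (t - ?a))"
    and x2: "?x t 2 = (if t \<le> ?a then (?\<rho> + \<epsilon>) * cos t - \<epsilon> else - later_radius \<epsilon> (t - ?a) * sin (t - ?a))" for t
    using n by (simp_all add: example_orbit_def)
  note x1' = x1[unfolded One_nat_def]
  have xi: "?x t i = 0" if "i \<in> {3..n}" for t i using that by (simp add: example_orbit_def)
  have lr0: "later_radius \<epsilon> 0 = ?\<sigma>" by (simp add: later_radius_def)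
  have lr_cont: "continuous_on UNIV (later_radius \<epsilon>)"
    unfolding later_radius_def by (intro continuous_intros continuous_on_cases_le) auto
  have lr: "continuous_on S (\<lambda>t. later_radius \<epsilon> (t - ?a))" for S
    by (rule continuous_on_compose2[OF lr_cont]) (auto intro!: continuous_intros)
  have cont1: "continuous_on {0..T} (\<lambda>t. ?x t 1)"
    unfolding x1 using fs(4)
    by (intro continuous_on_cases_le continuous_intros lr) (auto simp: lr0)
  have cont2: "continuous_on {0..T} (\<lambda>t. ?x t 2)"
    unfolding x2 using fs(3)
    by (intro continuous_on_cases_le continuous_intros lr) (auto simp: lr0)
  have cont: "continuous_on {0..T} (\<lambda>t. ?x t i)" if "i \<in> {1..n}" for i
  proof -
    consider "i = 1" | "i = 2" | "i \<in> {3..n}" using \<open>i \<in> {1..n}\<close> by fastforce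
    then show ?thesis by cases (use cont1 cont2 xi in auto)
  qed
  have sinT: "sin (3 * (pi / 2)) = - 1" "cos (3 * (pi / 2)) = 0"
    using sin_add[of pi "pi / 2"] cos_add[of pi "pi / 2"] by (simp_all add: field_simps)
  have T: "?a < T" using pi_gt_zero unfolding T_def by linarith
  have "\<not> 3 * (pi / 2) \<le> pi / 2" using pi_gt_zero by linarith
  then have lrT: "later_radius \<epsilon> (3 * (pi / 2)) = ?\<rho>"
    by (simp only: later_radius_def if_False mult_1_right)
  have Ta: "T - ?a = 3 * (pi / 2)" by (simp add: T_def)
  have "?x 0 1 = 0" "?x 0 2 = ?\<rho>"
    using fs(1) unfolding x1 x2 by simp_all
  moreover have "?x T 1 = 0" "?x T 2 = ?\<rho>"
    using T unfolding x1 x2 Ta lrT sinT by simp_all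
  ultimately have ends: "?x 0 1 = 0" "?x 0 2 = ?\<rho>" "?x T 1 = 0" "?x T 2 = ?\<rho>" by blast+
  have "?x T = ?x 0"
  proof
    fix i
    consider "i \<notin> {1..n}" | "i = 1" | "i = 2" | "i \<in> {3..n}" by fastforce
    then show "?x T i = ?x 0 i"
    proof cases
      case 1 then show ?thesis by (auto simp: example_orbit_def)
    qed (use ends xi in auto)
  qed
  \<comment> \<open>Region 1 ends at \<open>?a\<close>, and each later region takes a quarter turn.
    The case \<open>k = 0\<close> is separate because \<open>k - 1\<close> is truncated.\<close>
  define \<tau> where "\<tau> k = (if k = 0 then 0 else ?a + real (k - 1) * (pi / 2))" for k :: nat
  have deriv: "((\<lambda>s. ?x s i) has_real_derivative vfield (example_field n) \<epsilon> k (?x t) i) (at t)"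
    if d1: "((\<lambda>s. ?x s 1) has_real_derivative ?x t 2 + (if k = 1 then \<epsilon> else if k = 2 then - \<epsilon> * ?x t 1 else 0)) (at t)"
      and d2: "((\<lambda>s. ?x s 2) has_real_derivative - ?x t 1 + (if k = 2 then - \<epsilon> * ?x t 2 else 0)) (at t)"
      and i: "i \<in> {1..n}" for i k t
  proof -
    consider "i = 1" | "i = 2" | "i \<in> {3..n}" using i by fastforce
    then show ?thesis
      unfolding example_vfield[OF i] using d1 d2 by cases (auto simp: xi)
  qed
  have piece: "?x t \<in> region k \<and>
      (\<forall>i\<in>{1..n}. ((\<lambda>s. ?x s i) has_real_derivative vfield (example_field n) \<epsilon> k (?x t) i) (at t))"
    if k: "k \<in> {1..4}" and t: "t \<in> {\<tau> (k - 1)<..<\<tau> k}" for k t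
  proof -
    consider "k = 1" "t \<in> {0<..<?a}" | "k = 2" "t \<in> {?a<..<?a + pi / 2}"
      | "2 < k" "?a + pi / 2 < t"
    proof -
      consider "k = 1" | "k = 2" | "k = 3" | "k = 4" using k by fastforce
      then show thesis
      proof cases
        case 4
        moreover have "?a + pi / 2 < t" using t 4 pi_gt_zero by (simp add: \<tau>_def)
        ultimately show thesis using that(3) by simp
      qed (use t that in \<open>auto simp: \<tau>_def\<close>)
    qed
    then show ?thesis
    proof cases
      case 1
      have "0 \<le> sin t" using 1 fs by (intro sin_ge_zero) auto
      \<comment> \<open>The cosine decreases, so \<open>x 2\<close> is at least 0, its value at
        \<open>?a\<close>.\<close>
      moreover have "cos ?a \<le> cos t" using 1 fs pi_gt_zero by (intro cos_monotone_0_pi_le) auto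
      then have "(?\<rho> + \<epsilon>) * cos ?a \<le> (?\<rho> + \<epsilon>) * cos t" using \<rho> \<epsilon> by simp
      ultimately have "?x t \<in> region k" using 1 \<rho> \<epsilon> fs(3) by (simp add: region_def x1' x2)
      moreover have "((\<lambda>s. ?x s 1) has_real_derivative ?x t 2 + \<epsilon>) (at t)"
        by (rule has_field_derivative_transform_within_open[of "\<lambda>s. (?\<rho> + \<epsilon>) * sin s" _ _ "{..<?a}"])
          (use 1 in \<open>auto simp: x1' x2 intro!: derivative_eq_intros\<close>)
      moreover have "((\<lambda>s. ?x s 2) has_real_derivative - ?x t 1) (at t)"
        by (rule has_field_derivative_transform_within_open[of "\<lambda>s. (?\<rho> + \<epsilon>) * cos s - \<epsilon>" _ _ "{..<?a}"])
          (use 1 in \<open>auto simp: x1' x2 intro!: derivative_eq_intros\<close>)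
      ultimately show ?thesis using deriv[of t 1] 1 by simp
    next
      case 2
      let ?r = "\<lambda>s. ?\<rho> * exp (\<epsilon> * (pi / 2 - (s - ?a)))"
      have "0 < cos (t - ?a)" "0 < sin (t - ?a)"
        using 2 by (auto intro!: cos_gt_zero sin_gt_zero)
      then have "?x t \<in> region k"
        using 2 \<rho> by (simp add: region_def x1' x2 later_radius_def)
      moreover have "((\<lambda>s. ?x s 1) has_real_derivative ?x t 2 + - \<epsilon> * ?x t 1) (at t)"
        by (rule has_field_derivative_transform_within_open[of "\<lambda>s. ?r s * cos (s - ?a)" _ _ "{?a<..<?a + pi / 2}"])
          (use 2 in \<open>auto simp: x1' x2 later_radius_def algebra_simps intro!: derivative_eq_intros\<close>)
      moreover have "((\<lambda>s. ?x s 2) has_real_derivative - ?x t 1 + - \<epsilon> * ?x t 2) (at t)"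
        by (rule has_field_derivative_transform_within_open[of "\<lambda>s. - ?r s * sin (s - ?a)" _ _ "{?a<..<?a + pi / 2}"])
          (use 2 in \<open>auto simp: x1' x2 later_radius_def algebra_simps intro!: derivative_eq_intros\<close>)
      ultimately show ?thesis using deriv[of t 2] 2 by simp
    next
      case 3
      have k34: "k = 3 \<or> k = 4" using 3 k by auto
      have later: "?x s 1 = ?\<rho> * cos (s - ?a)" "?x s 2 = - ?\<rho> * sin (s - ?a)" if "?a + pi / 2 < s" for s
      proof -
        have "?a < s" using that pi_gt_zero by linarith
        then show "?x s 1 = ?\<rho> * cos (s - ?a)" "?x s 2 = - ?\<rho> * sin (s - ?a)"
          using that by (simp_all add: x1' x2 later_radius_def)
      qed
      have "?x t \<in> region k"
      proof (cases "k = 3")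
        case True
        then have "pi / 2 < t - ?a" "t - ?a < pi" using t by (simp_all add: \<tau>_def)
        then have "0 < sin (t - ?a)" "cos (t - ?a) < 0"
          using sin_gt_zero[of "t - ?a"] cos_gt_zero_pi[of "t - ?a - pi"] pi_gt_zero by simp_all
        then show ?thesis using True \<rho> later[OF 3(2)] by (simp add: region_def mult_less_0_iff)
      next
        case False
        then have "k = 4" using k34 by simp
        then have "pi < t - ?a" "t - ?a < 3 * (pi / 2)" using t by (simp_all add: \<tau>_def)
        then have "0 < sin (t - ?a - pi)" "0 < cos (t - ?a - pi)"
          using sin_gt_zero[of "t - ?a - pi"] cos_gt_zero_pi[of "t - ?a - pi"] pi_gt_zero by simp_all
        then have "sin (t - ?a) < 0" "cos (t - ?a) < 0" by simp_all
        then show ?thesis using \<open>k = 4\<close> \<rho> later[OF 3(2)] by (simp add: region_def mult_less_0_iff)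
      qed
      moreover have "((\<lambda>s. ?x s 1) has_real_derivative ?x t 2) (at t)"
        by (rule has_field_derivative_transform_within_open[of "\<lambda>s. ?\<rho> * cos (s - ?a)" _ _ "{?a + pi / 2<..}"])
          (use 3 later in \<open>auto intro!: derivative_eq_intros\<close>)
      moreover have "((\<lambda>s. ?x s 2) has_real_derivative - ?x t 1) (at t)"
        by (rule has_field_derivative_transform_within_open[of "\<lambda>s. - ?\<rho> * sin (s - ?a)" _ _ "{?a + pi / 2<..}"])
          (use 3 later in \<open>auto intro!: derivative_eq_intros\<close>)
      ultimately show ?thesis using deriv[of t k] 3 by simp
    qed
  qed
  have mono: "\<tau> (k - 1) < \<tau> k" if k: "k \<in> {1..4}" for k
  proof -
    have "k = 1 \<or> k = 2 \<or> k = 3 \<or> k = 4" using k by auto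
    then show ?thesis using fs(1) pi_gt_zero by (auto simp: \<tau>_def)
  qed
  have "one_turn_periodic n (example_field n) \<epsilon> ?x T"
    unfolding one_turn_periodic_def
  proof (intro conjI exI[of _ \<tau>] ballI)
    show "?x t \<in> points n" for t by (simp add: points_def example_orbit_def)
    show "0 < ?x 0 2" using ends \<rho> by simp
    show "\<tau> 4 = T" by (simp add: \<tau>_def T_def)
  qed (use cont ends \<open>?x T = ?x 0\<close> mono piece in \<open>auto simp: \<tau>_def[of 0]\<close>)
  then show ?thesis by (simp add: T_def)
qed

section \<open>Convergence to the unperturbed orbit\<close>

text \<open>In region 1 the orbit lies on a circle of radius
  \<open>amplitude \<epsilon> + \<epsilon>\<close> whose centre has distance
  \<open>\<epsilon>\<close> from the origin. Afterwards the radius is between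
  \<open>amplitude \<epsilon>\<close> and its value at the switch, which the fixed point equation
  bounds.\<close>

lemma example_orbit_radius:
  assumes n: "2 \<le> n" and \<epsilon>: "0 < \<epsilon>" and t: "0 \<le> t"
  shows "(amplitude \<epsilon>)\<^sup>2 \<le> (example_orbit n \<epsilon> t 1)\<^sup>2 + (example_orbit n \<epsilon> t 2)\<^sup>2"
    "(example_orbit n \<epsilon> t 1)\<^sup>2 + (example_orbit n \<epsilon> t 2)\<^sup>2 \<le> (amplitude \<epsilon> + 2 * \<epsilon>)\<^sup>2"
proof -
  let ?a = "first_switch \<epsilon>" and ?\<rho> = "amplitude \<epsilon>" and ?N = "(example_orbit n \<epsilon> t 1)\<^sup>2 + (example_orbit n \<epsilon> t 2)\<^sup>2"
  note fs = first_switch[OF \<epsilon>] and \<rho> = amplitude_pos[OF \<epsilon>]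
  have "?\<rho>\<^sup>2 \<le> ?N \<and> ?N \<le> (?\<rho> + 2 * \<epsilon>)\<^sup>2"
  proof (cases "t \<le> ?a")
    case True
    have "?N = ((?\<rho> + \<epsilon>) * sin t)\<^sup>2 + ((?\<rho> + \<epsilon>) * cos t - \<epsilon>)\<^sup>2"
      using n True by (simp add: example_orbit_def)
    also have "\<dots> = (?\<rho> + \<epsilon>)\<^sup>2 * ((sin t)\<^sup>2 + (cos t)\<^sup>2) - 2 * (?\<rho> + \<epsilon>) * \<epsilon> * cos t + \<epsilon>\<^sup>2"
      by (simp add: power2_eq_square algebra_simps del: sin_cos_squared_add sin_cos_squared_add2 sin_cos_squared_add3)
    finally have N: "?N = (?\<rho> + \<epsilon>)\<^sup>2 - 2 * (?\<rho> + \<epsilon>) * \<epsilon> * cos t + \<epsilon>\<^sup>2" by simp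
    have "\<bar>2 * (?\<rho> + \<epsilon>) * \<epsilon> * cos t\<bar> \<le> 2 * (?\<rho> + \<epsilon>) * \<epsilon> * 1"
      unfolding abs_mult using \<rho> \<epsilon> by (intro mult_mono) auto
    then have "2 * (?\<rho> + \<epsilon>) * \<epsilon> * cos t \<le> 2 * (?\<rho> + \<epsilon>) * \<epsilon>" "- (2 * (?\<rho> + \<epsilon>) * \<epsilon>) \<le> 2 * (?\<rho> + \<epsilon>) * \<epsilon> * cos t"
      by linarith+
    then show ?thesis unfolding N by (simp add: power2_eq_square algebra_simps)
  next
    case False
    let ?L = "later_radius \<epsilon> (t - ?a)"
    have "?N = (?L * cos (t - ?a))\<^sup>2 + (- ?L * sin (t - ?a))\<^sup>2"
      using n False by (simp add: example_orbit_def)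
    also have "\<dots> = ?L\<^sup>2 * ((sin (t - ?a))\<^sup>2 + (cos (t - ?a))\<^sup>2)"
      unfolding distrib_left by (simp add: power_mult_distrib)
    finally have N: "?N = ?L\<^sup>2" by simp
    have L: "?\<rho> \<le> ?L" "?L \<le> ?\<rho> * exp (\<epsilon> * (pi / 2))"
      using later_radius_bounds[OF \<epsilon>, of "t - ?a"] False by auto
    have "?L\<^sup>2 \<le> (?\<rho> * exp (\<epsilon> * (pi / 2)))\<^sup>2" using L \<rho> by (intro power_mono) auto
    also have "\<dots> = (?\<rho> + \<epsilon>)\<^sup>2 - \<epsilon>\<^sup>2" using amplitude_eq_iff[OF \<epsilon> \<rho>] by simp
    also have "\<dots> \<le> (?\<rho> + 2 * \<epsilon>)\<^sup>2" using \<rho> \<epsilon> by (simp add: power2_eq_square algebra_simps)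
    finally show ?thesis using N L \<rho> by (auto intro: power_mono)
  qed
  then show "?\<rho>\<^sup>2 \<le> ?N" "?N \<le> (?\<rho> + 2 * \<epsilon>)\<^sup>2" by auto
qed

text \<open>For this \<open>h 1\<close> the radius \<open>sqrt (2 * h 1)\<close> equals
  \<open>2 / pi\<close>, the limit of \<open>amplitude \<epsilon>\<close>.\<close>

definition example_zero :: "nat \<Rightarrow> nat \<Rightarrow> real" where
  "example_zero n = (\<lambda>i\<in>pars n. if i = 1 then 2 / pi\<^sup>2 else 0)"

text \<open>The point of the unperturbed circle with the same polar angle as \<open>y\<close> is at
  a distance equal to the difference of the radii. The angle is taken so that \<open>y 1\<close> is
  a sine and \<open>y 2\<close> a cosine, as on the orbit.\<close>

lemma near_example_zero_orbit:
  assumes n: "2 \<le> n" and lo: "\<rho>\<^sup>2 \<le> (y 1)\<^sup>2 + (y 2)\<^sup>2" "0 \<le> \<rho>" "2 / pi - \<rho> < \<eta>"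
    and hi: "(y 1)\<^sup>2 + (y 2)\<^sup>2 \<le> \<rho>'\<^sup>2" "0 \<le> \<rho>'" "\<rho>' - 2 / pi < \<eta>"
    and y: "\<And>i. i \<in> {3..n} \<Longrightarrow> y i = 0"
  shows "\<exists>t. L2_set (\<lambda>i. y i - unperturbed_orbit n (example_zero n) t i) {1..n} < \<eta>"
proof -
  define s where "s = sqrt ((y 1)\<^sup>2 + (y 2)\<^sup>2)"
  have s: "\<rho> \<le> s" "s \<le> \<rho>'" "0 \<le> s"
    using lo hi by (simp_all add: s_def real_le_rsqrt real_le_lsqrt)
  have ss: "s\<^sup>2 = (y 1)\<^sup>2 + (y 2)\<^sup>2" by (simp add: s_def)
  obtain t where t: "y 2 = s * cos t" "y 1 = s * sin t"
  proof (cases "s = 0")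
    case True
    then have "y 1 = 0 \<and> y 2 = 0" using ss by (simp add: sum_power2_eq_zero_iff)
    then show thesis using that[of 0] True by simp
  next
    case False
    have "(y 2 / s)\<^sup>2 + (y 1 / s)\<^sup>2 = ((y 1)\<^sup>2 + (y 2)\<^sup>2) / s\<^sup>2"
      by (simp add: power_divide add_divide_distrib add.commute)
    also have "\<dots> = 1" unfolding ss[symmetric] using False by simp
    finally have "(y 2 / s)\<^sup>2 + (y 1 / s)\<^sup>2 = 1" .
    then obtain t where "y 2 / s = cos t" "y 1 / s = sin t" using sincos_total_2pi by metis
    then show thesis using that[of t] False by (simp add: field_simps)
  qed
  have z: "sqrt (2 * example_zero n 1) = 2 / pi" "\<And>i. i \<in> {3..n} \<Longrightarrow> example_zero n i = 0"
    by (auto simp: example_zero_def pars_def real_sqrt_divide)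
  have "L2_set (\<lambda>i. y i - unperturbed_orbit n (example_zero n) t i) {1..n}
    = sqrt (\<Sum>i\<in>{1, 2}. (y i - unperturbed_orbit n (example_zero n) t i)\<^sup>2)"
    unfolding L2_set_def
    by (intro arg_cong[of _ _ sqrt] sum.mono_neutral_right)
      (use n y z in \<open>auto simp: unperturbed_orbit_def\<close>)
  also have "\<dots> = sqrt ((s * sin t - 2 / pi * sin t)\<^sup>2 + (s * cos t - 2 / pi * cos t)\<^sup>2)"
    using n z(1) by (simp add: unperturbed_orbit_def t(1) t(2)[unfolded One_nat_def])
  also have "(s * sin t - 2 / pi * sin t)\<^sup>2 + (s * cos t - 2 / pi * cos t)\<^sup>2
    = (s - 2 / pi)\<^sup>2 * ((sin t)\<^sup>2 + (cos t)\<^sup>2)"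
    unfolding left_diff_distrib[symmetric] power_mult_distrib distrib_left ..
  also have "sqrt \<dots> = \<bar>s - 2 / pi\<bar>" by simp
  also have "\<dots> < \<eta>" using s lo hi by linarith
  finally show ?thesis by blast
qed

lemma amplitude_tendsto:
  "((\<lambda>\<epsilon>. amplitude \<epsilon>) \<longlongrightarrow> 2 / pi) (at_right 0)" "((\<lambda>\<epsilon>. amplitude \<epsilon> + 2 * \<epsilon>) \<longlongrightarrow> 2 / pi) (at_right 0)"
proof -
  show *: "((\<lambda>\<epsilon>. amplitude \<epsilon>) \<longlongrightarrow> 2 / pi) (at_right 0)"
    unfolding amplitude_def by (real_asymp, (simp add: divide_inverse)?)
  have "((\<lambda>\<epsilon>::real. 2 * \<epsilon>) \<longlongrightarrow> 0) (at_right 0)" by real_asymp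
  from tendsto_add[OF * this] show "((\<lambda>\<epsilon>. amplitude \<epsilon> + 2 * \<epsilon>) \<longlongrightarrow> 2 / pi) (at_right 0)" by simp
qed

text \<open>For every \<open>\<epsilon> > 0\<close> there is exactly one periodic orbit closing
  after one turn, so uniqueness near the unperturbed orbit is immediate. Smallness of
  \<open>\<epsilon>\<close> only serves to place it in the given neighbourhood.\<close>

lemma example_bifurcates:
  assumes n: "2 \<le> n"
  shows "one_orbit_bifurcates n (example_field n) (example_zero n)"
  unfolding one_orbit_bifurcates_def
proof -
  have "\<forall>\<^sub>F \<epsilon> in at_right 0.
      \<exists>!\<Gamma>. periodic_orbit n (example_field n) \<epsilon> \<Gamma> \<and> within_nbhd n (example_zero n) \<eta> \<Gamma>" if "0 < \<eta>" for \<eta>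
  proof -
    have "\<forall>\<^sub>F \<epsilon> in at_right 0. 2 / pi - \<eta> < amplitude \<epsilon>"
      using order_tendstoD(1)[OF amplitude_tendsto(1)] that by simp
    moreover have "\<forall>\<^sub>F \<epsilon> in at_right 0. amplitude \<epsilon> + 2 * \<epsilon> < 2 / pi + \<eta>"
      using order_tendstoD(2)[OF amplitude_tendsto(2)] that by simp
    moreover have "\<forall>\<^sub>F \<epsilon>::real in at_right 0. 0 < \<epsilon>" by (rule eventually_at_right_less)
    ultimately show ?thesis
    proof eventually_elim
      case (elim \<epsilon>)
      note \<epsilon> = elim(3)
      let ?T = "first_switch \<epsilon> + 3 * (pi / 2)"
      show ?case
      proof (rule ex1I[of _ "example_orbit n \<epsilon> ` {0..?T}"], intro conjI)
        show "periodic_orbit n (example_field n) \<epsilon> (example_orbit n \<epsilon> ` {0..?T})"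
          using example_orbit_periodic[OF n \<epsilon>] by (auto simp: periodic_orbit_def)
        show "within_nbhd n (example_zero n) \<eta> (example_orbit n \<epsilon> ` {0..?T})"
          unfolding within_nbhd_def
        proof (clarify)
          fix t assume t: "t \<in> {0..?T}"
          show "\<exists>s. L2_set (\<lambda>i. example_orbit n \<epsilon> t i - unperturbed_orbit n (example_zero n) s i) {1..n} < \<eta>"
            by (rule near_example_zero_orbit[OF n, of "amplitude \<epsilon>" _ _ "amplitude \<epsilon> + 2 * \<epsilon>"])
              (use example_orbit_radius[OF n \<epsilon>, of t] t amplitude_pos[OF \<epsilon>] elim
                in \<open>auto simp: example_orbit_def\<close>)
        qed
        fix \<Gamma> assume "periodic_orbit n (example_field n) \<epsilon> \<Gamma> \<and> within_nbhd n (example_zero n) \<eta> \<Gamma>"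
        then obtain x T where x: "one_turn_periodic n (example_field n) \<epsilon> x T" "\<Gamma> = x ` {0..T}"
          by (auto simp: periodic_orbit_def)
        from example_periodic_solution_unique[OF n \<epsilon> x(1)]
        show "\<Gamma> = example_orbit n \<epsilon> ` {0..?T}" unfolding x(2) by (auto simp del: atLeastAtMost_iff intro!: image_cong)
      qed
    qed
  qed
  then show "\<forall>\<^sub>F \<eta> in at_right 0. \<forall>\<^sub>F \<epsilon> in at_right 0.
      \<exists>!\<Gamma>. periodic_orbit n (example_field n) \<epsilon> \<Gamma> \<and> within_nbhd n (example_zero n) \<eta> \<Gamma>"
    using eventually_at_right_less[of "0::real"] by (rule eventually_mono[rotated])
qed

section \<open>The Melnikov function of the example\<close>

text \<open>For \<open>j = 1\<close>, region 1 contributes the integral of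
  \<open>sqrt (2 * h 1) * sin t\<close>, which is the radius, and region 2 contributes
  \<open>- 2 * h 1\<close> during a time \<open>pi / 2\<close>. The other components integrate
  \<open>- h j\<close> over a full turn.\<close>

lemma example_melnikov:
  assumes n: "2 \<le> n" and h: "0 < h 1" and j: "j \<in> pars n"
  shows "melnikov n (example_field n) h j = (if j = 1 then sqrt (2 * h 1) - pi * h 1 else - 2 * pi * h j)"
proof -
  let ?r = "sqrt (2 * h 1)"
  define f where "f k t = (if j = 1 then (if k = 1 then ?r * sin t else if k = 2 then - 2 * h 1 else 0) else - h j)"
    for k :: nat and t :: real
  have i12: "1 \<in> {1..n}" "2 \<in> {1..n}" using n by auto
  have orb: "unperturbed_orbit n h t 1 = ?r * sin t" "unperturbed_orbit n h t 2 = ?r * cos t" for t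
    using n by (simp_all add: unperturbed_orbit_def)
  have rr: "?r * ?r = 2 * h 1" using h by simp
  have "(if j = 1 then unperturbed_orbit n h t 1 * example_field n k 1 (unperturbed_orbit n h t)
      + unperturbed_orbit n h t 2 * example_field n k 2 (unperturbed_orbit n h t)
      else example_field n k j (unperturbed_orbit n h t)) = f k t" for k t
  proof (cases "j = 1")
    case True
    have "- (r * a * (r * a)) - r * b * (r * b) = - (r * r) * (a\<^sup>2 + b\<^sup>2)" for r a b :: real
      by (simp add: power2_eq_square algebra_simps)
    from this[of ?r "sin t" "cos t"]
     have "- (?r * sin t * (?r * sin t)) - ?r * cos t * (?r * cos t) = - (2 * h 1)"
      unfolding rr by simp
    then show ?thesis using True unfolding orb example_field[OF i12(1)] example_field[OF i12(2)] orb
      by (simp add: f_def)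
  next
    case False
    then have "j \<in> {1..n}" "3 \<le> j" using j by (auto simp: pars_def)
    then show ?thesis using False by (simp add: example_field f_def unperturbed_orbit_def)
  qed
  then have "melnikov n (example_field n) h j = (\<Sum>k=1..4. integral (quarter k) (f k))"
    unfolding melnikov_quarters[of n h, OF n h] melnikov_integrand[OF n j] by simp
  also have "\<dots> = integral (quarter 1) (f 1) + integral (quarter 2) (f 2)
      + integral (quarter 3) (f 3) + integral (quarter 4) (f 4)"
  proof -
    have "{1..4} = {1, 2, 3, 4 :: nat}" by auto
    then show ?thesis by simp
  qed
  also have "\<dots> = (if j = 1 then ?r - pi * h 1 else - 2 * pi * h j)"
  proof (cases "j = 1")
    case True
    have "((\<lambda>t. ?r * sin t) has_integral (- ?r * cos (pi / 2)) - (- ?r * cos 0)) {0..pi / 2}"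
      by (rule fundamental_theorem_of_calculus)
        (auto simp flip: has_real_derivative_iff_has_vector_derivative intro!: derivative_eq_intros)
    then have "integral (quarter 1) (f 1) = ?r"
      using True by (simp add: quarter_def f_def[abs_def] integral_unique)
    then show ?thesis
      using True pi_gt_zero by (simp add: quarter_def f_def[abs_def])
  next
    case False
    then show ?thesis using pi_gt_zero by (simp add: quarter_def f_def[abs_def] field_simps)
  qed
  finally show ?thesis .
qed

lemma example_zero_energy: "example_zero n 1 = 2 / pi\<^sup>2"
  by (simp add: example_zero_def pars_def)

lemma example_jacobian:
  assumes n: "2 \<le> n" and p: "p \<in> pars n" and q: "q \<in> pars n"
  shows "partial_deriv (\<lambda>h. melnikov n (example_field n) h p) q (example_zero n) =
    (if p = q then (if p = 1 then - (pi / 2) else - 2 * pi) else 0)"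
  unfolding partial_deriv_def
proof (rule DERIV_imp_deriv, rule has_field_derivative_transform_within_open)
  let ?z = "example_zero n"
  let ?f = "\<lambda>s. if p = 1 then sqrt (2 * (?z(q := s)) 1) - pi * (?z(q := s)) 1 else - 2 * pi * (?z(q := s)) p"
  have z1: "?z 1 = 2 / pi\<^sup>2" by (rule example_zero_energy)
  have r: "sqrt (4 / pi\<^sup>2) = 2 / pi" by (simp add: real_sqrt_divide)
  show "(?f has_real_derivative (if p = q then (if p = 1 then - (pi / 2) else - 2 * pi) else 0)) (at (?z q))"
  proof (cases "p = q")
    case True
    show ?thesis
    proof (cases "p = 1")
      case p1: True
      \<comment> \<open>At this point the root has derivative
        \<open>1 / (2 / pi) = pi / 2\<close>.\<close>
      have "((\<lambda>s. sqrt (2 * s) - pi * s) has_real_derivative - (pi / 2)) (at (2 / pi\<^sup>2))"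
        by (auto simp: r field_simps intro!: derivative_eq_intros)
      then show ?thesis using True p1 z1 by simp
    next
      case False
      then show ?thesis using True by (auto intro!: derivative_eq_intros)
    qed
  next
    case False
    then have "?f = (\<lambda>_. if p = 1 then sqrt (2 * ?z 1) - pi * ?z 1 else - 2 * pi * ?z p)" by auto
    then show ?thesis using False by simp
  qed
  show "open (if q = 1 then {0<..} else UNIV :: real set)" by simp
  show "?z q \<in> (if q = 1 then {0<..} else UNIV)" using z1 by simp
  fix s :: real assume "s \<in> (if q = 1 then {0<..} else UNIV)"
  then have "0 < (?z(q := s)) 1" using z1 by auto
  from example_melnikov[of n "?z(q := s)", OF n this p]
  show "?f s = melnikov n (example_field n) (?z(q := s)) p" by simp
qed

text \<open>The first equation reads \<open>sqrt (2 * h 1) = pi * h 1\<close> and has a single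
  positive solution; the others give \<open>h j = 0\<close>. There the Jacobian is diagonal with
  nonzero entries.\<close>

lemma example_simple_zeros:
  assumes n: "2 \<le> n"
  shows "simple_zeros n (example_field n) = {example_zero n}"
proof
  show "simple_zeros n (example_field n) \<subseteq> {example_zero n}"
  proof
    fix h assume h: "h \<in> simple_zeros n (example_field n)"
    then have pos: "0 < h 1" and ext: "h \<in> extensional (pars n)"
      and zero: "\<And>j. j \<in> pars n \<Longrightarrow> melnikov n (example_field n) h j = 0"
      by (auto simp: simple_zeros_def annulus_def PiE_def)
    have h1: "h 1 = 2 / pi\<^sup>2"
    proof -
      have "sqrt (2 * h 1) = pi * h 1"
        using zero[of 1] example_melnikov[of n h 1, OF n pos] by (simp add: pars_def)
      then have "2 * h 1 = (pi * h 1)\<^sup>2" using pos by (metis real_sqrt_pow2 less_imp_le mult_pos_pos zero_less_numeral)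
      then have "h 1 * 2 = h 1 * (pi\<^sup>2 * h 1)" by (simp add: power2_eq_square algebra_simps)
      then have "2 = pi\<^sup>2 * h 1" using pos by simp
      then show ?thesis by (simp add: field_simps)
    qed
    have "h j = 0" if "j \<in> pars n" "j \<noteq> 1" for j
      using zero[of j] example_melnikov[of n h j, OF n pos] that by simp
    then show "h \<in> {example_zero n}"
      using h1 ext by (auto simp: example_zero_def extensional_def fun_eq_iff)
  qed
  let ?J = "melnikov_jacobian n (example_field n) (example_zero n)"
  have par: "par p \<in> pars n" if "p < n - 1" for p
    using bij_betw_apply[OF bij_betw_par[OF n]] that by simp
  have par_eq: "par p = par q \<longleftrightarrow> p = q" for p q by (auto simp: par_def)
  have J: "?J = Matrix.mat (n - 1) (n - 1)
      (\<lambda>(p, q). if p = q then (if p = 0 then - (pi / 2) else - 2 * pi) else 0)"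
    unfolding melnikov_jacobian_def
    by (rule eq_matI) (auto simp: example_jacobian[OF n par par] par_eq, auto simp: par_def)
  have "Determinant.det ?J = prod_list (diag_mat ?J)"
    by (rule det_upper_triangular[of _ "n - 1"]) (auto simp: J)
  also have "\<dots> \<noteq> 0"
    by (auto simp: J diag_mat_def prod_list_zero_iff)
  finally have "Determinant.det ?J \<noteq> 0" .
  moreover have "melnikov n (example_field n) (example_zero n) j = 0" if "j \<in> pars n" for j
  proof -
    have pos: "0 < example_zero n 1" by (subst example_zero_energy) simp
    have "sqrt (4 / pi\<^sup>2) = 2 / pi" by (simp add: real_sqrt_divide)
    then show ?thesis
      using example_melnikov[of n "example_zero n" j, OF n pos that] that
      by (auto simp: example_zero_def pars_def power2_eq_square)
  qed
  moreover have "example_zero n \<in> annulus n"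
    by (auto simp: annulus_def example_zero_def pars_def)
  ultimately show "{example_zero n} \<subseteq> simple_zeros n (example_field n)"
    by (simp add: simple_zeros_def)
qed

theorem theorem1p2:
  fixes n m :: nat
  assumes "2 \<le> n" and "1 \<le> m"
  shows "(2 \<le> m \<longrightarrow>
           (\<forall>c. finite (simple_zeros n (perturbation n m c)) \<and>
                card (simple_zeros n (perturbation n m c)) \<le> m ^ (n - 1))) \<and>
         (m = 1 \<longrightarrow>
           (\<exists>c h. simple_zeros n (perturbation n m c) = {h} \<and>
                  one_orbit_bifurcates n (perturbation n m c) h))"
proof (intro conjI impI allI)
  fix c assume "2 \<le> m"
  show "finite (simple_zeros n (perturbation n m c))"
    "card (simple_zeros n (perturbation n m c)) \<le> m ^ (n - 1)"
    using simple_zeros_le[OF assms] by blast+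
next
  assume "m = 1"
  then show "\<exists>c h. simple_zeros n (perturbation n m c) = {h} \<and>
                   one_orbit_bifurcates n (perturbation n m c) h"
    using example_simple_zeros[OF assms(1)] example_bifurcates[OF assms(1)]
    unfolding example_field_def by blast
qed

end
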